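(* Let $n\ge 1$, $N=2^n$, and let $H$ be the $N\times N$ Hadamard matrix with rows and columns indexed by $\mathbb{F}_2^n$ and entries $H_{x,y}=(-1)^{\langle x,y\rangle}$, where $\langle\cdot,\cdot\rangle$ is the standard dot product over $\mathbb{F}_2$. Then $$n-1\ \le\ \operatorname{ind}_{\mathbb{Z}_2}(S(H))\ \le\ 2n+1 .$$
   Context: Sign complex. For a sign matrix $A\in\{-1,1,*\}^{M\times N}$ and each row $r$ of $A$, let $\sigma_r^+=\{i^+: r_i=+1\}\cup\{i^-: r_i=-1\}$ and $\sigma_r^-=\{i^-: r_i=+1\}\cup\{i^+: r_i=-1\}$, where $i$ ranges over column indices and $i^+,i^-$ are two disjoint copies of the column index $i$. The sign complex $S(A)$ is the abstract simplicial complex whose simplices are all subsets of $\sigma_r^+$ or $\sigma_r^-$ over all rows $r$. The involution $i^+\leftrightarrow i^-$ is a free simplicial $\mathbb{Z}_2$-action on $S(A)$, inducing a free action on the geometric realization $|S(A)|$. Index. For a free $\mathbb{Z}_2$-complex $K$, $\operatorname{ind}_{\mathbb{Z}_2}(K)$ is the minimum $d\ge 0$ for which there is a continuous $\mathbb{Z}_2$-equivariant map $|K|\to\mathbb{S}^d$, where $\mathbb{S}^d$ carries the antipodal action. *)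

theory Defs
  imports "HOL-Analysis.Analysis" "HOL-Library.Z2" "HOL-Library.Extended_Nat"
begin

section \<open>Simplicial complexes and their geometric realization\<close>

definition simplicial_complex :: "'v set set \<Rightarrow> bool" where
  "simplicial_complex K \<longleftrightarrow>
     (\<forall>\<sigma>\<in>K. finite \<sigma>) \<and> (\<forall>\<sigma>\<in>K. \<forall>\<tau>. \<tau> \<subseteq> \<sigma> \<longrightarrow> \<tau> \<in> K)"

text \<open>The closed geometric simplex spanned by a finite vertex set, in barycentric coordinates.\<close>

definition simplex_points :: "'v set \<Rightarrow> ('v \<Rightarrow> real) set" where
  "simplex_points \<sigma> =
     {\<alpha>. (\<forall>v. 0 \<le> \<alpha> v) \<and> (\<forall>v. v \<notin> \<sigma> \<longrightarrow> \<alpha> v = 0) \<and> (\<Sum>v\<in>\<sigma>. \<alpha> v) = 1}"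

definition realization_points :: "'v set set \<Rightarrow> ('v \<Rightarrow> real) set" where
  "realization_points K = (\<Union>\<sigma>\<in>K. simplex_points \<sigma>)"

text \<open>A set is open in the realization iff its trace on every closed simplex is open for the
  Euclidean topology of that simplex (the weak topology).\<close>

definition realization :: "'v set set \<Rightarrow> ('v \<Rightarrow> real) topology" where
  "realization K = topology (\<lambda>U. U \<subseteq> realization_points K \<and>
     (\<forall>\<sigma>\<in>K. openin (subtopology (powertop_real UNIV) (simplex_points \<sigma>))
                    (U \<inter> simplex_points \<sigma>)))"

lemma openin_realization:
  "openin (realization K) U \<longleftrightarrow> U \<subseteq> realization_points K \<and>
     (\<forall>\<sigma>\<in>K. openin (subtopology (powertop_real UNIV) (simplex_points \<sigma>))
                    (U \<inter> simplex_points \<sigma>))"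
proof -
  have "istopology (\<lambda>U. U \<subseteq> realization_points K \<and>
     (\<forall>\<sigma>\<in>K. openin (subtopology (powertop_real UNIV) (simplex_points \<sigma>))
                    (U \<inter> simplex_points \<sigma>)))" (is "istopology ?P")
    unfolding istopology_def
  proof (intro conjI allI impI)
    fix S T assume "?P S" "?P T"
    moreover have "S \<inter> T \<inter> simplex_points \<sigma> =
        (S \<inter> simplex_points \<sigma>) \<inter> (T \<inter> simplex_points \<sigma>)" for \<sigma> by auto
    ultimately show "S \<inter> T \<subseteq> realization_points K"
      and "\<forall>\<sigma>\<in>K. openin (subtopology (powertop_real UNIV) (simplex_points \<sigma>))
                    (S \<inter> T \<inter> simplex_points \<sigma>)"
      by (auto intro: openin_Int)
  next
    fix \<U> assume *: "\<forall>U\<in>\<U>. ?P U"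
    then show "\<Union>\<U> \<subseteq> realization_points K" by auto
    have eq: "\<Union>\<U> \<inter> simplex_points \<sigma> = \<Union>((\<lambda>U. U \<inter> simplex_points \<sigma>) ` \<U>)" for \<sigma> by auto
    show "\<forall>\<sigma>\<in>K. openin (subtopology (powertop_real UNIV) (simplex_points \<sigma>))
                    (\<Union>\<U> \<inter> simplex_points \<sigma>)"
      unfolding eq using * by (intro ballI openin_Union) blast
  qed
  then show ?thesis
    by (simp add: realization_def topology_inverse')
qed

lemma topspace_realization: "topspace (realization K) = realization_points K"
proof (rule antisym)
  show "topspace (realization K) \<subseteq> realization_points K"
    using openin_realization openin_topspace by blast
  have "realization_points K \<inter> simplex_points \<sigma> = simplex_points \<sigma>" if "\<sigma> \<in> K" for \<sigma>
    using that by (auto simp: realization_points_def)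
  moreover have "openin (subtopology (powertop_real UNIV) S) S" for S :: "('a \<Rightarrow> real) set"
    using openin_topspace[of "subtopology (powertop_real UNIV) S"] by simp
  ultimately have "openin (realization K) (realization_points K)"
    by (simp add: openin_realization)
  then show "realization_points K \<subseteq> topspace (realization K)"
    by (rule openin_subset)
qed

section \<open>Free $Z_2$-complexes and the $Z_2$-index\<close>

text \<open>The map on realizations induced by a simplicial involution \<open>\<nu>\<close> sends the barycentric
  coordinate function \<open>\<alpha>\<close> to \<open>\<alpha> \<circ> \<nu>\<close>, because \<open>\<nu>\<close> is its own inverse.\<close>

definition free_Z2_complex :: "'v set set \<Rightarrow> ('v \<Rightarrow> 'v) \<Rightarrow> bool" where
  "free_Z2_complex K \<nu> \<longleftrightarrow>
     simplicial_complex K \<and> (\<forall>v. \<nu> (\<nu> v) = v) \<and> (\<forall>\<sigma>\<in>K. \<nu> ` \<sigma> \<in> K) \<and>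
     (\<forall>\<alpha>\<in>topspace (realization K). \<alpha> \<circ> \<nu> \<noteq> \<alpha>)"

definition Z2_map_to_sphere ::
    "'v set set \<Rightarrow> ('v \<Rightarrow> 'v) \<Rightarrow> nat \<Rightarrow> (('v \<Rightarrow> real) \<Rightarrow> (nat \<Rightarrow> real)) \<Rightarrow> bool" where
  "Z2_map_to_sphere K \<nu> d f \<longleftrightarrow>
     continuous_map (realization K) (nsphere d) f \<and>
     (\<forall>\<alpha>\<in>topspace (realization K). f (\<alpha> \<circ> \<nu>) = (\<lambda>i. - f \<alpha> i))"

text \<open>The infimum in \<^typ>\<open>enat\<close> is a minimum whenever some equivariant map to a sphere exists,
  and \<open>\<infinity>\<close> otherwise.\<close>

definition Z2_index :: "'v set set \<Rightarrow> ('v \<Rightarrow> 'v) \<Rightarrow> enat" where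
  "Z2_index K \<nu> = Inf {enat d | d. \<exists>f. Z2_map_to_sphere K \<nu> d f}"

section \<open>The sign complex of a sign matrix\<close>

text \<open>A sign matrix with row index set \<open>R\<close> and column index set \<open>C\<close> is an integer-valued
  function \<open>A\<close> with values in \<open>{-1, 1, 0}\<close> on \<open>R \<times> C\<close>; the value \<open>0\<close> stands for the entry
  \<open>*\<close>. \<open>Pos i\<close> and \<open>Neg i\<close> are the two copies of the column index \<open>i\<close>.\<close>

datatype 'c signed_index = Pos 'c | Neg 'c

fun flip_sign :: "'c signed_index \<Rightarrow> 'c signed_index" where
  "flip_sign (Pos i) = Neg i"
| "flip_sign (Neg i) = Pos i"

definition sigma_plus :: "'c set \<Rightarrow> ('c \<Rightarrow> int) \<Rightarrow> 'c signed_index set" where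
  "sigma_plus C r = {Pos i | i. i \<in> C \<and> r i = 1} \<union> {Neg i | i. i \<in> C \<and> r i = -1}"

definition sigma_minus :: "'c set \<Rightarrow> ('c \<Rightarrow> int) \<Rightarrow> 'c signed_index set" where
  "sigma_minus C r = {Neg i | i. i \<in> C \<and> r i = 1} \<union> {Pos i | i. i \<in> C \<and> r i = -1}"

definition sign_complex ::
    "'r set \<Rightarrow> 'c set \<Rightarrow> ('r \<Rightarrow> 'c \<Rightarrow> int) \<Rightarrow> 'c signed_index set set" where
  "sign_complex R C A =
     {\<sigma>. \<exists>r\<in>R. \<sigma> \<subseteq> sigma_plus C (A r) \<or> \<sigma> \<subseteq> sigma_minus C (A r)}"

lemma flip_sign_flip_sign [simp]: "flip_sign (flip_sign v) = v"
  by (cases v) auto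

lemma flip_sign_image_sigma:
  "flip_sign ` sigma_plus C r = sigma_minus C r"
  "flip_sign ` sigma_minus C r = sigma_plus C r"
  by (force simp: sigma_plus_def sigma_minus_def image_iff)+

lemma flip_sign_notin_sigma:
  "v \<in> sigma_plus C r \<Longrightarrow> flip_sign v \<notin> sigma_plus C r"
  "v \<in> sigma_minus C r \<Longrightarrow> flip_sign v \<notin> sigma_minus C r"
  by (auto simp: sigma_plus_def sigma_minus_def)

lemma free_Z2_complex_sign_complex:
  assumes "finite C"
  shows "free_Z2_complex (sign_complex R C A) flip_sign"
  unfolding free_Z2_complex_def
proof (intro conjI ballI allI)
  have "finite (sigma_plus C r)" "finite (sigma_minus C r)" for r
    using assms by (auto simp: sigma_plus_def sigma_minus_def)
  then show "simplicial_complex (sign_complex R C A)"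
    by (auto simp: simplicial_complex_def sign_complex_def intro: finite_subset) blast+
next
  fix \<sigma> assume "\<sigma> \<in> sign_complex R C A"
  then show "flip_sign ` \<sigma> \<in> sign_complex R C A"
    unfolding sign_complex_def using flip_sign_image_sigma image_mono by (smt (verit) mem_Collect_eq)
next
  fix \<alpha> assume "\<alpha> \<in> topspace (realization (sign_complex R C A))"
  then obtain \<sigma> where \<sigma>: "\<sigma> \<in> sign_complex R C A" "\<alpha> \<in> simplex_points \<sigma>"
    by (auto simp: topspace_realization realization_points_def)
  then obtain v where v: "v \<in> \<sigma>" "\<alpha> v \<noteq> 0"
    by (metis (mono_tags, lifting) mem_Collect_eq simplex_points_def sum.neutral zero_neq_one)
  have "flip_sign v \<notin> \<sigma>"
    using \<sigma>(1) v(1) flip_sign_notin_sigma unfolding sign_complex_def by blast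
  then have "\<alpha> (flip_sign v) = 0"
    using \<sigma>(2) by (auto simp: simplex_points_def)
  with v(2) show "\<alpha> \<circ> flip_sign \<noteq> \<alpha>"
    by (metis comp_apply)
qed simp

section \<open>The Hadamard matrix\<close>

text \<open>Vectors over the two-element field \<^typ>\<open>bit\<close> with coordinates indexed by \<open>{..<n}\<close>.\<close>

definition F2_space :: "nat \<Rightarrow> (nat \<Rightarrow> bit) set" where
  "F2_space n = {..<n} \<rightarrow>\<^sub>E UNIV"

definition F2_dot :: "nat \<Rightarrow> (nat \<Rightarrow> bit) \<Rightarrow> (nat \<Rightarrow> bit) \<Rightarrow> bit" where
  "F2_dot n x y = (\<Sum>i<n. x i * y i)"

definition hadamard :: "nat \<Rightarrow> (nat \<Rightarrow> bit) \<Rightarrow> (nat \<Rightarrow> bit) \<Rightarrow> int" where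
  "hadamard n x y = (-1) ^ (of_bit (F2_dot n x y))"

lemma card_F2_space: "card (F2_space n) = 2 ^ n"
proof -
  have "(UNIV :: bit set) = {0, 1}"
    by (auto simp: set_eq_iff)
  then have "card (UNIV :: bit set) = 2"
    by (metis card_2_iff zero_neq_one)
  then show ?thesis
    by (simp add: F2_space_def card_PiE)
qed

end

theory Submission
  imports Defs "HOL-Homology.Homology" "HOL-Library.Discrete_Functions"
begin

text \<open>Both bounds come from explicit equivariant maps.

\<^bold>\<open>Lower bound.\<close> The standard basis vectors are \<open>n\<close> columns on which the rows of the
Hadamard matrix realize all sign patterns. So \<open>S(H)\<close> contains the boundary complex of an
\<open>n\<close>-dimensional cross-polytope, and the sphere of dimension \<open>n - 1\<close> maps equivariantly into
\<open>|S(H)|\<close>. By the Borsuk-Ulam theorem there is no equivariant map from there to a sphere of smaller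
dimension.

\<^bold>\<open>Upper bound.\<close> For a nonempty simplex \<open>\<sigma>\<close> consider the rows \<open>x\<close> one of whose two facets contains
\<open>\<sigma>\<close>. They form an affine subspace \<open>X(\<sigma>)\<close> over the two-element field, which can only shrink as
\<open>\<sigma>\<close> grows, and at least halves whenever it changes. So the dimension of \<open>X(\<sigma>)\<close>, a number
between \<open>0\<close> and \<open>n\<close>, labels the vertices of the barycentric subdivision, and along a chain of simplices
with equal label the set \<open>X(\<sigma>)\<close> is constant. Choosing one row of each \<open>X(\<sigma>)\<close> and recording which of
its two facets contains \<open>\<sigma>\<close> gives a sign that is reversed by the involution and constant along
such chains. Sending the barycentre of \<open>\<sigma>\<close> to the unit vector of its label with this sign is then a
map into the boundary of a cross-polytope of dimension \<open>n + 1\<close>. This gives the bound \<open>n\<close>, hence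
also \<open>2 * n + 1\<close>; see \<open>Z2_index_le_rank\<close>.

\<^bold>\<open>Borsuk-Ulam.\<close> It follows from the fact that an odd self-map of a sphere has odd degree, which is
proved by induction on the dimension. If the map preserves the equator, then
\<open>Borsuk_odd_mapping_degree_step\<close> compares its degree mod 2 with that of its restriction to the
equator. A general odd map is homotopic to a Lipschitz one; the image of the equator under that is too
thin to meet every line through the origin, and a line that it misses allows an odd deformation pushing
the image of the equator into the equator.\<close>

section \<open>Maps to spheres by normalization\<close>

definition sphere_normalize :: "nat \<Rightarrow> (nat \<Rightarrow> real) \<Rightarrow> nat \<Rightarrow> real" where
  "sphere_normalize p x = (\<lambda>i. if i \<le> p then x i / sqrt (\<Sum>j\<le>p. (x j)\<^sup>2) else 0)"

lemma sphere_normalize_minus: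
  "sphere_normalize p (\<lambda>i. - x i) = (\<lambda>i. - sphere_normalize p x i)"
  by (auto simp: sphere_normalize_def)

lemma sphere_normalize_id:
  "x \<in> topspace (nsphere p) \<Longrightarrow> sphere_normalize p x = x"
  by (auto simp: sphere_normalize_def nsphere)

lemma continuous_map_sphere_normalize:
  assumes cont: "\<And>i. i \<le> p \<Longrightarrow> continuous_map X euclideanreal (\<lambda>x. F x i)"
    and nz: "\<And>x. x \<in> topspace X \<Longrightarrow> \<exists>i\<le>p. F x i \<noteq> 0"
  shows "continuous_map X (nsphere p) (\<lambda>x. sphere_normalize p (F x))"
proof -
  have pos: "(\<Sum>j\<le>p. (F x j)\<^sup>2) > 0" if "x \<in> topspace X" for x
  proof -
    obtain i where "i \<le> p" "F x i \<noteq> 0" using nz \<open>x \<in> topspace X\<close> by blast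
    then show ?thesis by (intro sum_pos2[of _ i]) auto
  qed
  have "continuous_map X euclideanreal (\<lambda>x. sphere_normalize p (F x) i)" for i
  proof (cases "i \<le> p")
    case True
    have "sqrt (\<Sum>j\<le>p. (F x j)\<^sup>2) \<noteq> 0" if "x \<in> topspace X" for x
      using pos[OF that] by simp
    then have "continuous_map X euclideanreal (\<lambda>x. F x i / sqrt (\<Sum>j\<le>p. (F x j)\<^sup>2))"
      by (intro continuous_intros cont True) auto
    then show ?thesis using True by (simp add: sphere_normalize_def)
  qed (simp add: sphere_normalize_def)
  moreover have "(\<Sum>i\<le>p. (sphere_normalize p (F x) i)\<^sup>2) = 1" if "x \<in> topspace X" for x
    using pos[OF that]
    by (simp add: sphere_normalize_def power_divide real_sqrt_pow2 less_imp_le sum_nonneg flip: sum_divide_distrib)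
  moreover have "sphere_normalize p (F x) i = 0" if "i > p" for x i
    using that by (simp add: sphere_normalize_def)
  ultimately show ?thesis
    by (auto simp: nsphere continuous_map_in_subtopology continuous_map_componentwise_UNIV)
qed

lemma homotopic_sphere_normalize:
  assumes cont: "\<And>i. i \<le> p \<Longrightarrow>
      continuous_map (prod_topology (top_of_set {0..1::real}) X) euclideanreal (\<lambda>z. H (fst z) (snd z) i)"
    and nz: "\<And>t x. 0 \<le> t \<Longrightarrow> t \<le> 1 \<Longrightarrow> x \<in> topspace X \<Longrightarrow> \<exists>i\<le>p. H t x i \<noteq> 0"
  shows "homotopic_with (\<lambda>_. True) X (nsphere p)
    (\<lambda>x. sphere_normalize p (H 0 x)) (\<lambda>x. sphere_normalize p (H 1 x))"
proof -
  have "continuous_map (prod_topology (top_of_set {0..1}) X) (nsphere p)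
      (\<lambda>z. sphere_normalize p (H (fst z) (snd z)))"
    by (rule continuous_map_sphere_normalize) (use cont nz in auto)
  then show ?thesis
    by (subst homotopic_with)
       (auto intro!: exI[of _ "\<lambda>z. sphere_normalize p (H (fst z) (snd z))"])
qed

section \<open>Lipschitz images of spheres miss a line\<close>

text \<open>A Lipschitz image of a \<open>(d - 1)\<close>-sphere cannot meet every line through the origin in \<open>d + 1\<close>
dimensions: the cone over it is a Lipschitz image of a subset of the \<open>d\<close>-cube. The proof is a volume
argument in discrete form. A grid of \<open>M ^ (d + 1)\<close> points at mutual distance at least \<open>\<delta> / M\<close> is compared
with \<open>O(M ^ d)\<close> cubical cells of side \<open>1 / K\<close> in the cone over \<open>E\<close>. If every grid point were hit, two
of them would come from the same cell, and be too close to each other. The grid lies in the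
open positive orthant, so that all coordinates of the direction found are positive.\<close>

lemma lipschitz_image_misses_line:
  fixes h :: "(nat \<Rightarrow> real) \<Rightarrow> nat \<Rightarrow> real"
  assumes unit: "\<And>x. x \<in> E \<Longrightarrow> (\<Sum>j<d. (x j)\<^sup>2) = 1"
    and sym: "\<And>x. x \<in> E \<Longrightarrow> (\<lambda>i. - x i) \<in> E"
    and odd: "\<And>x i. x \<in> E \<Longrightarrow> i \<le> d \<Longrightarrow> h (\<lambda>i. - x i) i = - h x i"
    and lip: "\<And>x y i. x \<in> E \<Longrightarrow> y \<in> E \<Longrightarrow> i \<le> d \<Longrightarrow> \<bar>h x i - h y i\<bar> \<le> L * (\<Sum>j<d. \<bar>x j - y j\<bar>)"
    and bd: "\<And>x i. x \<in> E \<Longrightarrow> i \<le> d \<Longrightarrow> \<bar>h x i\<bar> \<le> B"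
    and low: "\<And>x. x \<in> E \<Longrightarrow> \<exists>i\<le>d. \<delta> \<le> \<bar>h x i\<bar>"
    and "0 < \<delta>" "0 \<le> L" "0 \<le> B"
  obtains p where "\<And>i. i \<le> d \<Longrightarrow> p i > 0"
    and "\<And>x s. x \<in> E \<Longrightarrow> \<exists>i\<le>d. p i \<noteq> s * h x i"
proof -
  \<comment> \<open>Points of the cone whose coordinates agree up to \<open>1 / K\<close> have images that agree up to
    \<open>C / K\<close>; the choice of \<open>c\<close> makes \<open>C / K\<close> smaller than the grid spacing \<open>\<delta> / M\<close>, and that of \<open>M\<close>
    makes the number \<open>(2 * K + 1) ^ d\<close> of cells smaller than the number \<open>M ^ (d + 1)\<close> of grid points.\<close>
  define C where "C = L * (d * (d + 1)) + B * d"
  have "C \<ge> 0" using \<open>0 \<le> L\<close> \<open>0 \<le> B\<close> by (simp add: C_def)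
  obtain c :: nat where c: "C / \<delta> < c" using reals_Archimedean2 by blast
  have "c > 0"
  proof (rule ccontr)
    assume "\<not> c > 0"
    then show False using c \<open>C \<ge> 0\<close> \<open>0 < \<delta>\<close> by (simp add: divide_less_0_iff)
  qed
  define M where "M = (3 * c) ^ d + 1"
  define K where "K = c * M"
  have "M > 0" by (simp add: M_def)
  then have "K > 0" using \<open>c > 0\<close> by (simp add: K_def)
  define Q where "Q = ({..d} \<rightarrow>\<^sub>E {1..M})"
  define P where "P = (\<lambda>(q::nat \<Rightarrow> nat) i. \<delta> * q i / M)"
  have "\<exists>q\<in>Q. \<forall>x\<in>E. \<forall>s. \<exists>i\<le>d. P q i \<noteq> s * h x i"
  proof (rule ccontr)
    assume contra: "\<not> ?thesis"
    have "\<exists>x s. x \<in> E \<and> 0 \<le> s \<and> (\<forall>i\<le>d. P q i = s * h x i)" if "q \<in> Q" for q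
    proof -
      obtain x s where xs: "x \<in> E" "\<And>i. i \<le> d \<Longrightarrow> P q i = s * h x i"
      proof -
        have "\<not> (\<forall>x\<in>E. \<forall>s. \<exists>i\<le>d. P q i \<noteq> s * h x i)"
          using contra \<open>q \<in> Q\<close> by (metis (no_types, lifting))
        then show ?thesis using that by auto
      qed
      show ?thesis
      proof (cases "s \<ge> 0")
        case True then show ?thesis using xs by blast
      next
        case False
        then show ?thesis
          using xs sym[OF xs(1)] odd[OF xs(1)]
          by (intro exI[of _ "\<lambda>i. - x i"] exI[of _ "- s"]) auto
      qed
    qed
    then obtain X S where X: "\<And>q. q \<in> Q \<Longrightarrow> X q \<in> E" and S0: "\<And>q. q \<in> Q \<Longrightarrow> 0 \<le> S q"
      and XS: "\<And>q i. q \<in> Q \<Longrightarrow> i \<le> d \<Longrightarrow> P q i = S q * h (X q) i"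
      by metis
    \<comment> \<open>The lower bound on \<open>h\<close> keeps the scaling factor, and with it the preimage, in the unit cube.\<close>
    have S1: "S q \<le> 1" if q: "q \<in> Q" for q
    proof -
      obtain i where i: "i \<le> d" "\<delta> \<le> \<bar>h (X q) i\<bar>" using low[OF X[OF q]] by blast
      have "q i \<le> M" using q i by (auto simp: Q_def PiE_iff)
      have "S q * \<delta> \<le> S q * \<bar>h (X q) i\<bar>" using i S0[OF q] by (intro mult_left_mono) auto
      also have "\<dots> = \<bar>P q i\<bar>" using XS[OF q i(1)] S0[OF q] by (simp add: abs_mult)
      also have "\<dots> = \<delta> * (q i / M)" using \<open>0 < \<delta>\<close> by (simp add: P_def)
      also have "\<dots> \<le> \<delta> * 1" using \<open>0 < \<delta>\<close> \<open>q i \<le> M\<close> \<open>M > 0\<close> by (intro mult_left_mono) auto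
      finally show ?thesis using \<open>0 < \<delta>\<close> by simp
    qed
    have coord: "\<bar>X q j\<bar> \<le> 1" if q: "q \<in> Q" and "j < d" for q j
    proof -
      have "(X q j)\<^sup>2 \<le> (\<Sum>j<d. (X q j)\<^sup>2)" using \<open>j < d\<close> by (intro member_le_sum) auto
      then show ?thesis using unit[OF X[OF q]] by (simp add: abs_square_le_1)
    qed
    define cell where "cell = (\<lambda>q. \<lambda>j\<in>{..<d}. \<lfloor>K * (S q * X q j)\<rfloor>)"
    have "cell ` Q \<subseteq> {..<d} \<rightarrow>\<^sub>E {- int K..int K}"
    proof (clarsimp simp: cell_def PiE_iff)
      fix q j assume q: "q \<in> Q" and j: "j < d"
      have "\<bar>S q * X q j\<bar> \<le> 1"
        using mult_mono[OF S1[OF q] coord[OF q j]] S0[OF q] by (simp add: abs_mult)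
      then have "\<bar>K * (S q * X q j)\<bar> \<le> K"
        by (simp add: abs_mult mult_left_le)
      then show "- int K \<le> \<lfloor>K * (S q * X q j)\<rfloor> \<and> \<lfloor>K * (S q * X q j)\<rfloor> \<le> int K"
        by (simp add: le_floor_iff floor_le_iff) linarith
    qed
    then have "card (cell ` Q) \<le> card ({..<d} \<rightarrow>\<^sub>E {- int K..int K})"
      by (intro card_mono finite_PiE) auto
    also have "\<dots> = (2 * K + 1) ^ d"
      by (simp add: card_PiE nat_add_distrib nat_mult_distrib)
    also have "\<dots> \<le> (3 * c * M) ^ d"
      using \<open>K > 0\<close> by (intro power_mono) (auto simp: K_def)
    also have "\<dots> = (3 * c) ^ d * M ^ d" by (simp add: power_mult_distrib)
    also have "\<dots> < M * M ^ d"
      using \<open>M > 0\<close> by (intro mult_strict_right_mono) (auto simp: M_def)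
    also have "\<dots> = card Q" by (simp add: Q_def card_PiE)
    finally have "\<not> inj_on cell Q" by (rule pigeonhole)
    then obtain q r where qr: "q \<in> Q" "r \<in> Q" "q \<noteq> r" "cell q = cell r"
      by (auto simp: inj_on_def)
    have near: "\<bar>S q * X q j - S r * X r j\<bar> \<le> 1 / K" if "j < d" for j
    proof -
      have "\<lfloor>K * (S q * X q j)\<rfloor> = \<lfloor>K * (S r * X r j)\<rfloor>"
        using fun_cong[OF qr(4), of j] that by (simp add: cell_def)
      then have "\<bar>K * (S q * X q j) - K * (S r * X r j)\<bar> \<le> 1" by linarith
      then have "K * \<bar>S q * X q j - S r * X r j\<bar> \<le> 1"
        by (simp add: abs_mult flip: right_diff_distrib)
      then show ?thesis using \<open>K > 0\<close> by (simp add: field_simps)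
    qed
    have L2: "L2_set (\<lambda>j. S w * X w j) {..<d} = S w" if "w \<in> Q" for w
      using unit[OF X[OF that]] S0[OF that]
      by (simp add: L2_set_def power_mult_distrib flip: sum_distrib_left)
    \<comment> \<open>The scaling factor is the Euclidean norm of the point of the cone, hence is 1-Lipschitz in it.\<close>
    have tri: "S u - S w \<le> d / K" if "u \<in> Q" "w \<in> Q" 
        and nr: "\<And>j. j < d \<Longrightarrow> \<bar>S u * X u j - S w * X w j\<bar> \<le> 1 / K" for u w
    proof -
      have "S u = L2_set (\<lambda>j. S w * X w j + (S u * X u j - S w * X w j)) {..<d}"
        using L2[OF that(1)] by simp
      also have "\<dots> \<le> S w + L2_set (\<lambda>j. S u * X u j - S w * X w j) {..<d}"
        using L2_set_triangle_ineq[of "\<lambda>j. S w * X w j"] L2[OF that(2)] by metis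
      also have "L2_set (\<lambda>j. S u * X u j - S w * X w j) {..<d} \<le> (\<Sum>j<d. \<bar>S u * X u j - S w * X w j\<bar>)"
        by (rule L2_set_le_sum_abs)
      also have "\<dots> \<le> (\<Sum>j<d. 1 / K)" using nr by (intro sum_mono) auto
      finally show ?thesis by simp
    qed
    have Sdiff: "\<bar>S q - S r\<bar> \<le> d / K"
    proof -
      have "S q - S r \<le> d / K" by (rule tri) (use qr near in auto)
      moreover have "S r - S q \<le> d / K"
        by (rule tri) (use qr near in \<open>auto simp: abs_minus_commute\<close>)
      ultimately show ?thesis by linarith
    qed
    have Xdiff: "S q * \<bar>X q j - X r j\<bar> \<le> (d + 1) / K" if j: "j < d" for j
    proof -
      have "S q * \<bar>X q j - X r j\<bar> = \<bar>S q * (X q j - X r j)\<bar>"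
        using S0[OF qr(1)] by (simp add: abs_mult)
      also have "\<dots> = \<bar>(S q * X q j - S r * X r j) - (S q - S r) * X r j\<bar>"
        by (simp add: algebra_simps)
      also have "\<dots> \<le> \<bar>S q * X q j - S r * X r j\<bar> + \<bar>S q - S r\<bar> * \<bar>X r j\<bar>"
        by (metis abs_triangle_ineq4 abs_mult)
      also have "\<dots> \<le> 1 / K + d / K * 1"
        using near[OF j] Sdiff coord[OF qr(2) j] by (intro add_mono mult_mono) auto
      finally show ?thesis by (simp add: add_divide_distrib add.commute)
    qed
    have Xsum: "S q * (\<Sum>j<d. \<bar>X q j - X r j\<bar>) \<le> d * (d + 1) / K"
    proof -
      have "S q * (\<Sum>j<d. \<bar>X q j - X r j\<bar>) = (\<Sum>j<d. S q * \<bar>X q j - X r j\<bar>)"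
        by (simp add: sum_distrib_left)
      also have "\<dots> \<le> (\<Sum>j<d. (d + 1) / K)" using Xdiff by (intro sum_mono) auto
      also have "\<dots> = d * (d + 1) / K" by (simp add: algebra_simps)
      finally show ?thesis .
    qed
    obtain i where i: "i \<le> d" "q i \<noteq> r i"
    proof -
      have "\<not> (\<forall>i\<in>{..d}. q i = r i)"
        using qr(1-3) PiE_ext unfolding Q_def by metis
      then show ?thesis using that by auto
    qed
    have "\<bar>P q i - P r i\<bar> = \<bar>S q * (h (X q) i - h (X r) i) + (S q - S r) * h (X r) i\<bar>"
      using XS[OF qr(1) i(1)] XS[OF qr(2) i(1)] by (simp add: algebra_simps)
    also have "\<dots> \<le> S q * \<bar>h (X q) i - h (X r) i\<bar> + \<bar>S q - S r\<bar> * \<bar>h (X r) i\<bar>"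
      using abs_triangle_ineq[of "S q * (h (X q) i - h (X r) i)" "(S q - S r) * h (X r) i"] S0[OF qr(1)] by (simp add: abs_mult)
    also have "\<dots> \<le> S q * (L * (\<Sum>j<d. \<bar>X q j - X r j\<bar>)) + d / K * B"
      using lip[OF X[OF qr(1)] X[OF qr(2)] i(1)] bd[OF X[OF qr(2)] i(1)] S0[OF qr(1)] Sdiff \<open>0 \<le> B\<close>
      by (intro add_mono mult_mono) auto
    also have "\<dots> = L * (S q * (\<Sum>j<d. \<bar>X q j - X r j\<bar>)) + d / K * B" by (simp add: algebra_simps)
    also have "\<dots> \<le> L * (d * (d + 1) / K) + d / K * B"
      using Xsum \<open>0 \<le> L\<close> by (intro add_mono mult_left_mono) auto
    also have "\<dots> = C / K" by (simp add: C_def field_simps add_divide_distrib)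
    also have "\<dots> < \<delta> / M"
      using c \<open>0 < \<delta>\<close> \<open>M > 0\<close> \<open>c > 0\<close> by (simp add: K_def field_simps)
    finally have "\<bar>P q i - P r i\<bar> < \<delta> / M" .
    moreover have "\<bar>P q i - P r i\<bar> = \<delta> / M * \<bar>real (q i) - real (r i)\<bar>"
      using \<open>0 < \<delta>\<close> by (simp add: P_def abs_mult flip: right_diff_distrib diff_divide_distrib)
    moreover have "\<bar>real (q i) - real (r i)\<bar> \<ge> 1" using i(2) by linarith
    ultimately show False
      using \<open>0 < \<delta>\<close> \<open>M > 0\<close> mult_left_mono[of 1 "\<bar>real (q i) - real (r i)\<bar>" "\<delta> / M"] by simp
  qed
  then obtain q where q: "q \<in> Q" "\<And>x s. x \<in> E \<Longrightarrow> \<exists>i\<le>d. P q i \<noteq> s * h x i" by blast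
  moreover have "P q i > 0" if "i \<le> d" for i
    using q(1) that \<open>0 < \<delta>\<close> \<open>M > 0\<close> by (force simp: Q_def P_def PiE_iff)
  ultimately show ?thesis using that by blast
qed

section \<open>The Borsuk-Ulam theorem\<close>

definition antipodal_map :: "nat \<Rightarrow> nat \<Rightarrow> ((nat \<Rightarrow> real) \<Rightarrow> nat \<Rightarrow> real) \<Rightarrow> bool" where
  "antipodal_map m d f \<longleftrightarrow> continuous_map (nsphere m) (nsphere d) f \<and>
     (\<forall>x\<in>topspace (nsphere m). f (\<lambda>i. - x i) = (\<lambda>i. - f x i))"

lemma uminus_in_nsphere:
  "x \<in> topspace (nsphere d) \<Longrightarrow> (\<lambda>i. - x i) \<in> topspace (nsphere d)"
  by (simp add: nsphere)

lemma nsphere_eq_top_of_set: "nsphere d = top_of_set (topspace (nsphere d))"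
  by (simp add: nsphere euclidean_product_topology)

lemma abs_nsphere_coord_le_1:
  assumes "x \<in> topspace (nsphere d)"
  shows "\<bar>x i\<bar> \<le> 1"
proof (cases "i \<le> d")
  case True
  have "(x i)\<^sup>2 \<le> (\<Sum>j\<le>d. (x j)\<^sup>2)" using True by (intro member_le_sum) auto
  then show ?thesis using assms by (simp add: nsphere abs_square_le_1)
qed (use assms in \<open>simp add: nsphere\<close>)

lemma nsphere_large_coord:
  assumes "x \<in> topspace (nsphere d)"
  obtains i where "i \<le> d" "1 / (d + 1) \<le> \<bar>x i\<bar>"
proof (rule ccontr)
  assume neg: "\<not> thesis"
  have small: "(x i)\<^sup>2 < 1 / (d + 1)" if "i \<le> d" for i
  proof -
    have "\<bar>x i\<bar> < 1 / (d + 1)" using neg that \<open>\<And>i. i \<le> d \<Longrightarrow> _ \<Longrightarrow> thesis\<close> by force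
    moreover have "\<bar>x i\<bar> * \<bar>x i\<bar> \<le> \<bar>x i\<bar> * 1"
      using abs_nsphere_coord_le_1[OF assms] by (intro mult_left_mono) auto
    ultimately show ?thesis by (simp add: power2_eq_square)
  qed
  have "(\<Sum>i\<le>d. (x i)\<^sup>2) < (\<Sum>i\<le>d. 1 / (d + 1))"
    using small by (intro sum_strict_mono) auto
  then show False using assms by (simp add: nsphere)
qed

lemma compact_topspace_nsphere: "compact (topspace (nsphere d))"
proof -
  have cont: "continuous_on UNIV (\<lambda>x::nat \<Rightarrow> real. x i)" for i by (rule continuous_on_product_coordinates)
  have eq: "topspace (nsphere d) = {x. (\<Sum>i\<le>d. (x i)\<^sup>2) = 1} \<inter> (\<Inter>i\<in>{d<..}. {x. x i = 0})"
    by (auto simp: nsphere)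
  have "closed (topspace (nsphere d))"
    unfolding eq by (intro closed_Int closed_INT ballI closed_Collect_eq
        continuous_on_sum continuous_on_const continuous_on_power cont)
  moreover have "compactin (powertop_real UNIV) (PiE UNIV (\<lambda>_::nat. {-1..1}))"
    by (simp add: compactin_PiE)
  then have "compact (PiE UNIV (\<lambda>_::nat. {-1..1::real}))"
    by (simp add: euclidean_product_topology)
  moreover have "topspace (nsphere d) \<subseteq> PiE UNIV (\<lambda>_. {-1..1})"
    using abs_nsphere_coord_le_1 by (fastforce simp: abs_le_iff)
  ultimately show ?thesis by (metis compact_Int_closed inf.absorb2)
qed

text \<open>The distance is the sum of the coordinate differences: it suits the counting argument above and
makes the coordinate functions 1-Lipschitz.\<close>

definition lipschitz_functions :: "nat \<Rightarrow> ((nat \<Rightarrow> real) \<Rightarrow> real) set" where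
  "lipschitz_functions d = {g. continuous_on (topspace (nsphere d)) g \<and>
     (\<exists>L\<ge>0. \<forall>x\<in>topspace (nsphere d). \<forall>y\<in>topspace (nsphere d).
        \<bar>g x - g y\<bar> \<le> L * (\<Sum>j\<le>d. \<bar>x j - y j\<bar>))}"

lemma function_ring_lipschitz:
  "function_ring_on (lipschitz_functions d) (topspace (nsphere d))"
proof
  let ?S = "topspace (nsphere d)" and ?D = "\<lambda>x y. \<Sum>j\<le>d. \<bar>x j - y j :: real\<bar>"
  have D0: "0 \<le> ?D x y" for x y by (simp add: sum_nonneg)
  show "compact ?S" by (rule compact_topspace_nsphere)
  show "continuous_on ?S f" if "f \<in> lipschitz_functions d" for f
    using that by (simp add: lipschitz_functions_def)
  show "(\<lambda>_. c) \<in> lipschitz_functions d" for c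
    by (auto simp: lipschitz_functions_def intro!: exI[of _ 0])
  fix f g assume "f \<in> lipschitz_functions d" "g \<in> lipschitz_functions d"
  then obtain L M where cont: "continuous_on ?S f" "continuous_on ?S g" and LM: "0 \<le> L" "0 \<le> M"
    and f: "\<And>x y. x \<in> ?S \<Longrightarrow> y \<in> ?S \<Longrightarrow> \<bar>f x - f y\<bar> \<le> L * ?D x y"
    and g: "\<And>x y. x \<in> ?S \<Longrightarrow> y \<in> ?S \<Longrightarrow> \<bar>g x - g y\<bar> \<le> M * ?D x y"
    unfolding lipschitz_functions_def by blast
  have "\<bar>f x + g x - (f y + g y)\<bar> \<le> (L + M) * ?D x y" if "x \<in> ?S" "y \<in> ?S" for x y
    using f[OF that] g[OF that] by (simp add: distrib_right)
  then show "(\<lambda>x. f x + g x) \<in> lipschitz_functions d"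
    using cont LM unfolding lipschitz_functions_def
    by (auto intro!: continuous_intros exI[of _ "L + M"])
  have "bounded (f ` ?S)" "bounded (g ` ?S)"
    using cont compact_topspace_nsphere by (auto intro!: compact_imp_bounded compact_continuous_image)
  then obtain A B where A: "\<And>x. x \<in> ?S \<Longrightarrow> \<bar>f x\<bar> \<le> A" and B: "\<And>x. x \<in> ?S \<Longrightarrow> \<bar>g x\<bar> \<le> B"
    by (auto simp: bounded_iff)
  have "?S \<noteq> {}" using in_topspace_nsphere by blast
  then have AB: "0 \<le> A" "0 \<le> B" using A B by (meson abs_ge_zero order_trans ex_in_conv)+
  have "\<bar>f x * g x - f y * g y\<bar> \<le> (A * M + B * L) * ?D x y" if xy: "x \<in> ?S" "y \<in> ?S" for x y
  proof -
    have "\<bar>f x * g x - f y * g y\<bar> = \<bar>f x * (g x - g y) + g y * (f x - f y)\<bar>"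
      by (simp add: algebra_simps)
    also have "\<dots> \<le> \<bar>f x\<bar> * \<bar>g x - g y\<bar> + \<bar>g y\<bar> * \<bar>f x - f y\<bar>"
      by (metis abs_mult abs_triangle_ineq)
    also have "\<dots> \<le> A * (M * ?D x y) + B * (L * ?D x y)"
      using A[OF xy(1)] B[OF xy(2)] f[OF xy] g[OF xy] AB by (intro add_mono mult_mono) auto
    finally show ?thesis by (simp add: algebra_simps)
  qed
  then show "(\<lambda>x. f x * g x) \<in> lipschitz_functions d"
    using cont LM AB unfolding lipschitz_functions_def
    by (auto intro!: continuous_intros exI[of _ "A * M + B * L"])
next
  let ?S = "topspace (nsphere d)"
  fix x y :: "nat \<Rightarrow> real" assume xy: "x \<in> ?S" "y \<in> ?S" "x \<noteq> y"
  then obtain i where i: "x i \<noteq> y i" by blast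
  then have "i \<le> d" using xy by (force simp: nsphere not_le[symmetric])
  have "\<bar>u i - v i\<bar> \<le> 1 * (\<Sum>j\<le>d. \<bar>u j - v j\<bar>)" for u v :: "nat \<Rightarrow> real"
    using member_le_sum[of i "{..d}" "\<lambda>j. \<bar>u j - v j\<bar>"] \<open>i \<le> d\<close> by simp
  moreover have "continuous_on ?S (\<lambda>x. x i)"
    by (rule continuous_on_subset[OF continuous_on_product_coordinates]) simp
  ultimately have "(\<lambda>x. x i) \<in> lipschitz_functions d"
    unfolding lipschitz_functions_def by (auto intro!: exI[of _ 1])
  then show "\<exists>f\<in>lipschitz_functions d. f x \<noteq> f y" by (rule bexI[rotated]) (rule i)
qed

text \<open>Lipschitz functions form an algebra that separates points, so by Stone-Weierstrass they approximate the
coordinates of \<open>f\<close>; taking odd parts preserves the quality of the approximation since \<open>f\<close> is odd.\<close>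

lemma odd_lipschitz_approximation:
  assumes f: "antipodal_map d d f" and "\<epsilon> > 0"
  obtains h L where "\<And>i. continuous_map (nsphere d) euclideanreal (\<lambda>x. h x i)"
    and "\<And>x i. h (\<lambda>i. - x i) i = - h x i"
    and "\<And>x i. x \<in> topspace (nsphere d) \<Longrightarrow> \<bar>h x i - f x i\<bar> < \<epsilon>"
    and "0 \<le> L"
    and "\<And>x y i. x \<in> topspace (nsphere d) \<Longrightarrow> y \<in> topspace (nsphere d) \<Longrightarrow> i \<le> d \<Longrightarrow>
      \<bar>h x i - h y i\<bar> \<le> L * (\<Sum>j\<le>d. \<bar>x j - y j\<bar>)"
proof -
  interpret function_ring_on "lipschitz_functions d" "topspace (nsphere d)"
    by (rule function_ring_lipschitz)
  let ?S = "topspace (nsphere d)"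
  have cm: "continuous_map (nsphere d) euclideanreal g \<longleftrightarrow> continuous_on ?S g" for g
    by (subst nsphere_eq_top_of_set) simp
  have fc: "continuous_map (nsphere d) euclideanreal (\<lambda>x. f x i)" for i
    using continuous_map_compose[OF _ continuous_map_nsphere_projection] f
    unfolding antipodal_map_def comp_def by blast
  have "\<exists>g\<in>lipschitz_functions d. \<forall>x\<in>?S. \<bar>f x i - g x\<bar> < \<epsilon>" for i
    using Stone_Weierstrass_basic[OF fc[of i, unfolded cm] \<open>\<epsilon> > 0\<close>] by auto
  then obtain g where g: "\<And>i. g i \<in> lipschitz_functions d" and gf: "\<And>i x. x \<in> ?S \<Longrightarrow> \<bar>f x i - g i x\<bar> < \<epsilon>"
    by metis
  then have "\<forall>i. \<exists>L\<ge>0. \<forall>x\<in>?S. \<forall>y\<in>?S. \<bar>g i x - g i y\<bar> \<le> L * (\<Sum>j\<le>d. \<bar>x j - y j\<bar>)"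
    unfolding lipschitz_functions_def by blast
  then obtain L where L0: "\<And>i. 0 \<le> L i"
    and L: "\<And>i x y. x \<in> ?S \<Longrightarrow> y \<in> ?S \<Longrightarrow> \<bar>g i x - g i y\<bar> \<le> L i * (\<Sum>j\<le>d. \<bar>x j - y j\<bar>)"
    by metis
  have gc: "continuous_map (nsphere d) euclideanreal (g i)" for i
    using g continuous cm by blast
  have neg: "continuous_map (nsphere d) (nsphere d) (\<lambda>x i. - x i)"
    by (auto simp: nsphere continuous_map_in_subtopology continuous_map_componentwise_UNIV
        intro!: continuous_intros continuous_map_from_subtopology)
  define h where "h x i = (g i x - g i (\<lambda>i. - x i)) / 2" for x i
  show ?thesis
  proof (rule that[of h "\<Sum>i\<le>d. L i"])
    show "continuous_map (nsphere d) euclideanreal (\<lambda>x. h x i)" for i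
      unfolding h_def
      by (intro continuous_intros gc continuous_map_compose[OF neg gc, unfolded comp_def]) auto
    show "h (\<lambda>i. - x i) i = - h x i" for x i by (simp add: h_def field_simps)
    show "0 \<le> (\<Sum>i\<le>d. L i)" using L0 by (simp add: sum_nonneg)
    show "\<bar>h x i - f x i\<bar> < \<epsilon>" if x: "x \<in> ?S" for x i
    proof -
      have "f (\<lambda>i. - x i) i = - f x i" using f x by (simp add: antipodal_map_def)
      then have "\<bar>f x i + g i (\<lambda>i. - x i)\<bar> < \<epsilon>"
        using gf[OF uminus_in_nsphere[OF x], of i] by (simp add: abs_less_iff)
      then show ?thesis
        using gf[OF x, of i] by (auto simp: h_def abs_less_iff field_simps)
    qed
    fix x y i assume xy: "x \<in> ?S" "y \<in> ?S" and i: "i \<le> d"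
    let ?D = "\<Sum>j\<le>d. \<bar>x j - y j\<bar>"
    have "(\<Sum>j\<le>d. \<bar>- x j - - y j\<bar>) = ?D" by (intro sum.cong) auto
    then have "\<bar>h x i - h y i\<bar> \<le> L i * ?D"
      using L[OF xy, of i] L[OF uminus_in_nsphere[OF xy(1)] uminus_in_nsphere[OF xy(2)], of i]
      by (auto simp: h_def abs_le_iff field_simps)
    also have "\<dots> \<le> (\<Sum>i\<le>d. L i) * ?D"
      using L0 i by (intro mult_right_mono member_le_sum) (auto simp: sum_nonneg)
    finally show "\<bar>h x i - h y i\<bar> \<le> (\<Sum>i\<le>d. L i) * ?D" .
  qed
qed

text \<open>In the inductive step \<open>f\<close> is deformed through nowhere vanishing odd maps, first linearly to a Lipschitz
map \<open>h\<close>, then to a map \<open>g\<close> that preserves the equator.\<close>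

theorem odd_degree_antipodal_map:
  "antipodal_map d d f \<Longrightarrow> odd (Brouwer_degree2 d f)"
proof (induction d arbitrary: f)
  case 0
  then have cf: "continuous_map (nsphere 0) (nsphere 0) f"
    and of: "\<And>x. x \<in> topspace (nsphere 0) \<Longrightarrow> f (\<lambda>i. - x i) = (\<lambda>i. - f x i)"
    by (auto simp: antipodal_map_def)
  \<comment> \<open>The 0-sphere has only two points, so \<open>f\<close> is the identity or the antipode, an involution in
    both cases.\<close>
  have "(f \<circ> f) x = id x" if x: "x \<in> topspace (nsphere 0)" for x
  proof -
    have fx: "f x \<in> topspace (nsphere 0)" using cf x by (auto simp: continuous_map_def)
    have "f x = x \<or> f x = (\<lambda>i. - x i)"
    proof -
      have "(f x 0)\<^sup>2 = (x 0)\<^sup>2" "\<And>i. i > 0 \<Longrightarrow> f x i = 0 \<and> x i = 0"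
        using x fx by (auto simp: nsphere)
      then show ?thesis by (metis (full_types) ext gr0I neg_equal_zero power2_eq_iff)
    qed
    then show ?thesis using of[OF x] by auto
  qed
  then have "Brouwer_degree2 0 (f \<circ> f) = Brouwer_degree2 0 id" by (rule Brouwer_degree2_eq)
  then have "Brouwer_degree2 0 f * Brouwer_degree2 0 f = 1"
    using Brouwer_degree2_compose[OF cf cf] by simp
  then show ?case by (metis even_mult_iff odd_one)
next
  case (Suc e)
  define d where "d = Suc e"
  have f: "antipodal_map d d f" using Suc.prems by (simp add: d_def)
  then have cf: "continuous_map (nsphere d) (nsphere d) f"
    and of: "\<And>x. x \<in> topspace (nsphere d) \<Longrightarrow> f (\<lambda>i. - x i) = (\<lambda>i. - f x i)"
    by (auto simp: antipodal_map_def)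
  let ?S = "topspace (nsphere d)"
  have fS: "f x \<in> ?S" if "x \<in> ?S" for x using cf that by (auto simp: continuous_map_def)
  define \<delta> :: real where "\<delta> = 1 / (2 * (d + 1))"
  have "\<delta> > 0" by (simp add: \<delta>_def)
  obtain h L where hc: "\<And>i. continuous_map (nsphere d) euclideanreal (\<lambda>x. h x i)"
    and hodd: "\<And>x i. h (\<lambda>i. - x i) i = - h x i"
    and hf: "\<And>x i. x \<in> ?S \<Longrightarrow> \<bar>h x i - f x i\<bar> < \<delta>"
    and "0 \<le> L"
    and hL: "\<And>x y i. x \<in> ?S \<Longrightarrow> y \<in> ?S \<Longrightarrow> i \<le> d \<Longrightarrow> \<bar>h x i - h y i\<bar> \<le> L * (\<Sum>j\<le>d. \<bar>x j - y j\<bar>)"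
    by (rule odd_lipschitz_approximation[OF f \<open>\<delta> > 0\<close>]) blast
  have flarge: "\<exists>i\<le>d. 2 * \<delta> \<le> \<bar>f x i\<bar>" if "x \<in> ?S" for x
  proof -
    obtain i where "i \<le> d" "1 / (d + 1) \<le> \<bar>f x i\<bar>" by (rule nsphere_large_coord[OF fS[OF \<open>x \<in> ?S\<close>]])
    moreover have "2 * \<delta> = 1 / (d + 1)" by (simp add: \<delta>_def field_simps)
    ultimately show ?thesis by auto
  qed
  have hlarge: "\<exists>i\<le>d. \<delta> \<le> \<bar>h x i\<bar>" if "x \<in> ?S" for x
  proof -
    obtain i where i: "i \<le> d" "2 * \<delta> \<le> \<bar>f x i\<bar>" using flarge[OF \<open>x \<in> ?S\<close>] by blast
    have "\<delta> \<le> \<bar>h x i\<bar>" using i(2) hf[OF \<open>x \<in> ?S\<close>, of i] by linarith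
    then show ?thesis using i(1) by blast
  qed
  define E where "E = {x \<in> ?S. x d = 0}"
  have sumE: "(\<Sum>j\<le>d. \<phi> j) = (\<Sum>j<d. \<phi> j)" if "\<phi> d = 0" for \<phi> :: "nat \<Rightarrow> real"
    using that by (simp flip: lessThan_Suc_atMost)
  obtain p where p: "\<And>i. i \<le> d \<Longrightarrow> p i > 0" and miss: "\<And>x s. x \<in> E \<Longrightarrow> \<exists>i\<le>d. p i \<noteq> s * h x i"
  proof (rule lipschitz_image_misses_line[of E d h L 2 \<delta>])
    show "(\<Sum>j<d. (x j)\<^sup>2) = 1" if "x \<in> E" for x
      using that sumE[of "\<lambda>j. (x j)\<^sup>2"] by (simp add: E_def nsphere)
    show "\<bar>h x i - h y i\<bar> \<le> L * (\<Sum>j<d. \<bar>x j - y j\<bar>)" if "x \<in> E" "y \<in> E" "i \<le> d" for x y i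
      using that hL[of x y i] sumE[of "\<lambda>j. \<bar>x j - y j\<bar>"] by (simp add: E_def)
    show "\<bar>h x i\<bar> \<le> 2" if "x \<in> E" "i \<le> d" for x i
    proof -
      have "x \<in> ?S" using that by (simp add: E_def)
      moreover have "\<delta> \<le> 1" by (simp add: \<delta>_def)
      ultimately show ?thesis
        using hf[of x i] abs_nsphere_coord_le_1[OF fS, of x i] by linarith
    qed
  qed (use hodd hlarge \<open>\<delta> > 0\<close> \<open>0 \<le> L\<close> uminus_in_nsphere in \<open>auto simp: E_def\<close>)
  have psnd: "continuous_map (prod_topology (top_of_set {0..1::real}) (nsphere d)) euclideanreal (\<lambda>z. \<phi> (snd z))"
    if "continuous_map (nsphere d) euclideanreal \<phi>" for \<phi>
    using continuous_map_compose[OF continuous_map_snd that] by (simp add: comp_def)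
  have pfst: "continuous_map (prod_topology (top_of_set {0..1::real}) (nsphere d)) euclideanreal fst"
    by (rule continuous_map_into_fulltopology[OF continuous_map_fst])
  have fc: "continuous_map (nsphere d) euclideanreal (\<lambda>x. f x i)" for i
    using continuous_map_compose[OF cf continuous_map_nsphere_projection] by (simp add: comp_def)
  have xc: "continuous_map (nsphere d) euclideanreal (\<lambda>x. x i)" for i
    by (rule continuous_map_nsphere_projection)

  define H where "H t x i = (1 - t) * f x i + t * h x i" for t x i
  have "homotopic_with (\<lambda>_. True) (nsphere d) (nsphere d)
      (\<lambda>x. sphere_normalize d (H 0 x)) (\<lambda>x. sphere_normalize d (H 1 x))"
  proof (rule homotopic_sphere_normalize)
    show "continuous_map (prod_topology (top_of_set {0..1}) (nsphere d)) euclideanreal (\<lambda>z. H (fst z) (snd z) i)" for i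
      unfolding H_def by (intro continuous_intros pfst psnd fc hc) auto
    fix t :: real and x assume t: "0 \<le> t" "t \<le> 1" and x: "x \<in> ?S"
    obtain i where i: "i \<le> d" "2 * \<delta> \<le> \<bar>f x i\<bar>" using flarge[OF x] by blast
    have "\<bar>t * (h x i - f x i)\<bar> \<le> 1 * \<bar>h x i - f x i\<bar>"
      unfolding abs_mult using t by (intro mult_right_mono) auto
    then have "\<bar>t * (h x i - f x i)\<bar> < \<delta>" using hf[OF x, of i] by simp
    moreover have "H t x i = f x i + t * (h x i - f x i)" by (simp add: H_def algebra_simps)
    ultimately have "H t x i \<noteq> 0" using i(2) \<open>\<delta> > 0\<close> by linarith
    then show "\<exists>i\<le>d. H t x i \<noteq> 0" using i(1) by blast
  qed
  moreover have "H 0 = f" "H 1 = h" by (simp_all add: H_def fun_eq_iff)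
  ultimately have "Brouwer_degree2 d (\<lambda>x. sphere_normalize d (f x)) = Brouwer_degree2 d (\<lambda>x. sphere_normalize d (h x))"
    using Brouwer_degree2_homotopic by force
  moreover have "Brouwer_degree2 d (\<lambda>x. sphere_normalize d (f x)) = Brouwer_degree2 d f"
    by (rule Brouwer_degree2_eq) (simp add: sphere_normalize_id fS)
  ultimately have deg_h: "Brouwer_degree2 d f = Brouwer_degree2 d (\<lambda>x. sphere_normalize d (h x))" by simp

  \<comment> \<open>The image of the equator under \<open>h\<close> misses the line through \<open>p\<close>. A shear moves this line to the last
    coordinate axis while the last coordinate is multiplied by a factor that ends up vanishing exactly on
    the equator. A zero could only arise where the sheared vector lies on that axis and the factor is
    zero, that is, on the equator with \<open>h x\<close> on the line through \<open>p\<close>.\<close>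
  define G where "G t x i = (if i < d then h x i - t * (p i / p d) * h x d
      else (1 - t + t * (x d)\<^sup>2) * h x d)" for t x i
  have Gnz: "\<exists>i\<le>d. G t x i \<noteq> 0" if t: "0 \<le> t" "t \<le> 1" and x: "x \<in> ?S" for t x
  proof (rule ccontr)
    assume "\<not> ?thesis"
    then have G0: "G t x i = 0" if "i \<le> d" for i using that by blast
    show False
    proof (cases "h x d = 0")
      case True
      then have "h x i = 0" if "i \<le> d" for i
        using G0[OF that] that by (cases "i = d") (auto simp: G_def)
      then show False using hlarge[OF x] \<open>\<delta> > 0\<close> by force
    next
      case False
      then have "(1 - t) + t * (x d)\<^sup>2 = 0" using G0[of d] by (simp add: G_def)
      moreover have "0 \<le> 1 - t" "0 \<le> t * (x d)\<^sup>2" using t by auto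
      ultimately have "1 - t = 0" "t * (x d)\<^sup>2 = 0" by linarith+
      then have "t = 1" "x d = 0" by auto
      then have "x \<in> E" using x by (simp add: E_def)
      moreover have "p i = (p d / h x d) * h x i" if "i \<le> d" for i
      proof (cases "i = d")
        case False
        then have "h x i = p i / p d * h x d" using G0[OF that] that \<open>t = 1\<close> by (simp add: G_def)
        then show ?thesis using \<open>h x d \<noteq> 0\<close> p[of d] by simp
      qed (use False in simp)
      ultimately show False using miss by blast
    qed
  qed
  have Gc: "continuous_map (prod_topology (top_of_set {0..1}) (nsphere d)) euclideanreal (\<lambda>z. G (fst z) (snd z) i)" for i
    unfolding G_def
    using p[of d] by (cases "i < d"; simp; intro continuous_intros pfst psnd xc hc; simp)
  define g where "g x = sphere_normalize d (G 1 x)" for x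
  have hom: "homotopic_with (\<lambda>_. True) (nsphere d) (nsphere d) (\<lambda>x. sphere_normalize d (G 0 x)) g"
    unfolding g_def by (rule homotopic_sphere_normalize) (use Gc Gnz in auto)
  have "sphere_normalize d (G 0 x) = sphere_normalize d (h x)" for x
    by (auto simp: sphere_normalize_def G_def fun_eq_iff intro!: arg_cong2[where f = divide] arg_cong[where f = sqrt] sum.cong)
  then have deg_g: "Brouwer_degree2 d f = Brouwer_degree2 d g"
    using Brouwer_degree2_homotopic[OF hom] deg_h by simp
  have cg: "continuous_map (nsphere d) (nsphere d) g"
    using homotopic_with_imp_continuous_maps[OF hom] by blast
  have godd: "g (\<lambda>i. - x i) = (\<lambda>i. - g x i)" for x
  proof -
    have "G 1 (\<lambda>i. - x i) = (\<lambda>i. - G 1 x i)" by (auto simp: G_def hodd fun_eq_iff)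
    then show ?thesis unfolding g_def by (metis sphere_normalize_minus)
  qed
  have equator: "nsphere e = subtopology (nsphere d) {x. x d = 0}"
    unfolding d_def by (rule subtopology_nsphere_equator[symmetric])
  have g0: "g x d = 0" if "x d = 0" for x
    using that by (simp add: g_def sphere_normalize_def G_def)
  have cg': "continuous_map (nsphere e) (nsphere e) g"
    unfolding equator using cg g0
    by (auto simp: continuous_map_in_subtopology intro: continuous_map_from_subtopology)
  have "odd (Brouwer_degree2 e g)"
    by (rule Suc.IH) (use cg' godd in \<open>simp add: antipodal_map_def\<close>)
  moreover have "even (Brouwer_degree2 d g - Brouwer_degree2 (d - Suc 0) g)"
    using cg godd cg' by (intro Borsuk_odd_mapping_degree_step) (auto simp: d_def continuous_map_def)
  ultimately show ?case using deg_g by (simp add: d_def)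
qed

text \<open>Viewed as a self-map of the larger sphere the map is not surjective, so its degree would be both zero
and odd.\<close>

theorem Borsuk_Ulam:
  assumes "antipodal_map m d f"
  shows "m \<le> d"
proof (rule ccontr)
  assume "\<not> m \<le> d"
  then have "d < m" by simp
  have sub: "topspace (nsphere d) \<subseteq> topspace (nsphere m) \<inter> {x. x m = 0}"
  proof
    fix x assume x: "x \<in> topspace (nsphere d)"
    then have "(\<Sum>i\<le>m. (x i)\<^sup>2) = (\<Sum>i\<le>d. (x i)\<^sup>2)"
      using \<open>d < m\<close> by (intro sum.mono_neutral_right) (auto simp: nsphere)
    then show "x \<in> topspace (nsphere m) \<inter> {x. x m = 0}"
      using x \<open>d < m\<close> by (auto simp: nsphere)
  qed
  have f: "continuous_map (nsphere m) (nsphere d) f"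
    using assms by (simp add: antipodal_map_def)
  then have fim: "f ` topspace (nsphere m) \<subseteq> topspace (nsphere d)"
    by (auto simp: continuous_map_def)
  have "continuous_map (nsphere m) (powertop_real UNIV) f"
    using f unfolding nsphere[of d] by (simp add: continuous_map_in_subtopology)
  then have cf: "continuous_map (nsphere m) (nsphere m) f"
    using fim sub unfolding nsphere[of m] by (auto simp: continuous_map_in_subtopology)
  have "(\<lambda>i. if i = m then 1 else 0) \<in> topspace (nsphere m)"
    by (simp add: nsphere if_distrib[where f = "\<lambda>x. x ^ 2"] cong: if_cong)
  moreover have "(\<lambda>i. if i = m then 1 else 0) \<notin> f ` topspace (nsphere m)"
    using fim sub by fastforce
  ultimately have "Brouwer_degree2 m f = 0"
    using cf by (intro Brouwer_degree2_nonsurjective) auto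
  moreover have "odd (Brouwer_degree2 m f)"
    using cf assms by (intro odd_degree_antipodal_map) (auto simp: antipodal_map_def)
  ultimately show False by simp
qed

section \<open>Continuity for geometric realizations\<close>

text \<open>The weak topology is finer than the coordinatewise one, so continuity out of the realization can be
checked coordinatewise.\<close>

lemma continuous_map_realization_if_coordinatewise:
  assumes "continuous_map (subtopology (powertop_real UNIV) (realization_points K)) Y f"
  shows "continuous_map (realization K) Y f"
proof (rule continuous_map_openin_preimage_eq[THEN iffD2], intro conjI allI impI)
  show "f \<in> topspace (realization K) \<rightarrow> topspace Y"
    using assms by (auto simp: continuous_map_def topspace_realization)
  fix U assume "openin Y U"
  then have "openin (subtopology (powertop_real UNIV) (realization_points K)) (realization_points K \<inter> f -` U)"
    using assms by (auto simp: continuous_map_openin_preimage_eq)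
  then obtain T where T: "openin (powertop_real UNIV) T" "realization_points K \<inter> f -` U = T \<inter> realization_points K"
    by (auto simp: openin_subtopology)
  have "realization_points K \<inter> f -` U \<inter> simplex_points \<sigma> = T \<inter> simplex_points \<sigma>" if "\<sigma> \<in> K" for \<sigma>
    using T(2) that by (auto simp: realization_points_def)
  then show "openin (realization K) (topspace (realization K) \<inter> f -` U)"
    using T(1) by (auto simp: openin_realization topspace_realization openin_subtopology)
qed

lemma closedin_simplex_points:
  assumes "finite \<sigma>"
  shows "closedin (powertop_real UNIV) (simplex_points \<sigma>)"
proof -
  have eq: "simplex_points \<sigma> = (\<Inter>v. {\<alpha>. 0 \<le> \<alpha> v}) \<inter> (\<Inter>v\<in>-\<sigma>. {\<alpha>. \<alpha> v = 0}) \<inter> {\<alpha>. (\<Sum>v\<in>\<sigma>. \<alpha> v) = 1}"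
    by (auto simp: simplex_points_def)
  have cont: "continuous_on UNIV (\<lambda>\<alpha>::'a \<Rightarrow> real. \<alpha> v)" for v by (rule continuous_on_product_coordinates)
  have "closed (simplex_points \<sigma>)"
    unfolding eq by (intro closed_Int closed_INT ballI closed_Collect_le closed_Collect_eq
        continuous_on_sum continuous_on_const cont)
  then show ?thesis by (simp add: euclidean_product_topology)
qed

text \<open>For a finite complex the weak topology is the coordinatewise one, because a set with closed trace on
each of finitely many closed simplices is a finite union of closed sets.\<close>

lemma continuous_map_into_realization:
  assumes "finite K" "simplicial_complex K"
    and f: "continuous_map X (powertop_real UNIV) f" and im: "f ` topspace X \<subseteq> realization_points K"
  shows "continuous_map X (realization K) f"
proof (rule continuous_map_openin_preimage_eq[THEN iffD2], intro conjI allI impI)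
  show "f \<in> topspace X \<rightarrow> topspace (realization K)"
    using im by (auto simp: topspace_realization)
  fix U assume U: "openin (realization K) U"
  have "closedin (powertop_real UNIV) (simplex_points \<sigma> - U)" if "\<sigma> \<in> K" for \<sigma>
  proof -
    have "closedin (powertop_real UNIV) (simplex_points \<sigma>)"
      using assms(2) that by (intro closedin_simplex_points) (auto simp: simplicial_complex_def)
    moreover obtain T where T: "openin (powertop_real UNIV) T" "U \<inter> simplex_points \<sigma> = T \<inter> simplex_points \<sigma>"
      using U \<open>\<sigma> \<in> K\<close> by (auto simp: openin_realization openin_subtopology)
    moreover have "simplex_points \<sigma> - U = simplex_points \<sigma> - T" using T(2) by auto
    ultimately show ?thesis by (simp add: closedin_diff)
  qed
  then have "closedin (powertop_real UNIV) (\<Union>\<sigma>\<in>K. simplex_points \<sigma> - U)"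
    using \<open>finite K\<close> by (intro closedin_Union) auto
  then have "closedin X (topspace X \<inter> f -` (\<Union>\<sigma>\<in>K. simplex_points \<sigma> - U))"
    using f by (auto simp: continuous_map_closedin_preimage_eq)
  moreover have "topspace X \<inter> f -` U = topspace X - (topspace X \<inter> f -` (\<Union>\<sigma>\<in>K. simplex_points \<sigma> - U))"
    using im by (auto simp: realization_points_def)
  ultimately show "openin X (topspace X \<inter> f -` U)" by (metis openin_diff openin_topspace)
qed

section \<open>Bounding the index from above by a signed rank function\<close>

text \<open>The weight is positive exactly when \<open>\<sigma>\<close> is a superlevel set of \<open>\<alpha>\<close> on \<open>V\<close>. For a fixed \<open>\<alpha>\<close>
these sets form a chain, as do the simplices carrying a point of the barycentric subdivision. The
weights thus act as continuous, unnormalized coordinates with respect to the subdivision.\<close>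

definition level_weight :: "'v set \<Rightarrow> 'v set \<Rightarrow> ('v \<Rightarrow> real) \<Rightarrow> real" where
  "level_weight V \<sigma> \<alpha> = (\<Prod>v\<in>\<sigma>. \<Prod>u\<in>V - \<sigma>. max 0 (\<alpha> v - \<alpha> u))"

lemma level_weight_nonneg: "0 \<le> level_weight V \<sigma> \<alpha>"
  by (simp add: level_weight_def prod_nonneg)

lemma level_weight_pos_iff:
  assumes "finite V" "\<sigma> \<subseteq> V"
  shows "0 < level_weight V \<sigma> \<alpha> \<longleftrightarrow> (\<forall>v\<in>\<sigma>. \<forall>u\<in>V - \<sigma>. \<alpha> u < \<alpha> v)"
proof -
  have "finite \<sigma>" using assms finite_subset by blast
  have "0 < level_weight V \<sigma> \<alpha> \<longleftrightarrow> level_weight V \<sigma> \<alpha> \<noteq> 0"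
    using level_weight_nonneg[of V \<sigma> \<alpha>] by linarith
  also have "\<dots> \<longleftrightarrow> (\<forall>v\<in>\<sigma>. \<forall>u\<in>V - \<sigma>. max 0 (\<alpha> v - \<alpha> u) \<noteq> 0)"
    using \<open>finite \<sigma>\<close> assms(1) by (simp add: level_weight_def)
  also have "\<dots> \<longleftrightarrow> (\<forall>v\<in>\<sigma>. \<forall>u\<in>V - \<sigma>. \<alpha> u < \<alpha> v)"
    by (intro ball_cong) (auto simp: max_def)
  finally show ?thesis .
qed

lemma level_sets_nested:
  assumes "finite V" "\<sigma> \<subseteq> V" "\<tau> \<subseteq> V" "0 < level_weight V \<sigma> \<alpha>" "0 < level_weight V \<tau> \<alpha>"
  shows "\<sigma> \<subseteq> \<tau> \<or> \<tau> \<subseteq> \<sigma>"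
proof (rule ccontr)
  assume "\<not> ?thesis"
  then obtain v u where "v \<in> \<sigma>" "v \<notin> \<tau>" "u \<in> \<tau>" "u \<notin> \<sigma>" by blast
  then have "\<alpha> u < \<alpha> v" "\<alpha> v < \<alpha> u"
    using assms by (auto simp: level_weight_pos_iff)
  then show False by simp
qed

lemma level_weight_involution:
  assumes inv: "\<And>v. \<nu> (\<nu> v) = v" and V: "\<nu> ` V = V"
  shows "level_weight V \<sigma> (\<alpha> \<circ> \<nu>) = level_weight V (\<nu> ` \<sigma>) \<alpha>"
proof -
  have inj: "inj \<nu>" by (metis inv injI)
  have "V - \<nu> ` \<sigma> = \<nu> ` (V - \<sigma>)" using V image_set_diff[OF inj] by metis
  then show ?thesis
    using inj by (simp add: level_weight_def prod.reindex inj_on_subset[OF inj])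
qed

text \<open>The pair of \<open>rank\<close> and \<open>sgn\<close> describes a simplicial equivariant map from the barycentric subdivision to
the boundary of a cross-polytope: \<open>\<sigma>\<close> is sent to the unit vector number \<open>rank \<sigma>\<close>, scaled by
\<open>sgn \<sigma>\<close>. The condition on chains says that no simplex is mapped onto a pair of antipodal vertices, so
that the linear extension with the level weights as coordinates has no zero.\<close>

theorem Z2_index_le_rank:
  fixes K :: "'v set set" and rank :: "'v set \<Rightarrow> nat" and sgn :: "'v set \<Rightarrow> real"
  assumes K: "free_Z2_complex K \<nu>" and fin: "finite K"
    and rank_le: "\<And>\<sigma>. \<sigma> \<in> K \<Longrightarrow> \<sigma> \<noteq> {} \<Longrightarrow> rank \<sigma> \<le> m"
    and rank_sym: "\<And>\<sigma>. \<sigma> \<in> K \<Longrightarrow> \<sigma> \<noteq> {} \<Longrightarrow> rank (\<nu> ` \<sigma>) = rank \<sigma>"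
    and sgn_nz: "\<And>\<sigma>. \<sigma> \<in> K \<Longrightarrow> \<sigma> \<noteq> {} \<Longrightarrow> sgn \<sigma> \<noteq> 0"
    and sgn_odd: "\<And>\<sigma>. \<sigma> \<in> K \<Longrightarrow> \<sigma> \<noteq> {} \<Longrightarrow> sgn (\<nu> ` \<sigma>) = - sgn \<sigma>"
    and sgn_chain: "\<And>\<sigma> \<tau>. \<tau> \<in> K \<Longrightarrow> \<sigma> \<noteq> {} \<Longrightarrow> \<sigma> \<subseteq> \<tau> \<Longrightarrow> rank \<sigma> = rank \<tau> \<Longrightarrow> sgn \<sigma> = sgn \<tau>"
  shows "Z2_index K \<nu> \<le> enat m"
proof -
  have sc: "simplicial_complex K" and inv: "\<And>v. \<nu> (\<nu> v) = v" and nuK: "\<And>\<sigma>. \<sigma> \<in> K \<Longrightarrow> \<nu> ` \<sigma> \<in> K"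
    using K by (auto simp: free_Z2_complex_def)
  have nu2: "\<nu> ` \<nu> ` \<sigma> = \<sigma>" for \<sigma> by (simp add: image_image inv)
  define V where "V = \<Union>K"
  have "finite V" using fin sc by (auto simp: V_def simplicial_complex_def)
  have sub: "\<sigma> \<subseteq> V" if "\<sigma> \<in> K" for \<sigma> using that by (auto simp: V_def)
  have nuV: "\<nu> ` V = V"
  proof
    show "\<nu> ` V \<subseteq> V" using nuK by (auto simp: V_def)
    then show "V \<subseteq> \<nu> ` V" using nu2[of V] image_mono by metis
  qed
  define KK where "KK k = {\<sigma> \<in> K. \<sigma> \<noteq> {} \<and> rank \<sigma> = k}" for k
  define F where "F \<alpha> k = (\<Sum>\<sigma>\<in>KK k. sgn \<sigma> * level_weight V \<sigma> \<alpha>)" for \<alpha> k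
  have finKK: "finite (KK k)" for k using fin by (auto simp: KK_def)
  have nz: "\<exists>k\<le>m. F \<alpha> k \<noteq> 0" if \<alpha>: "\<alpha> \<in> realization_points K" for \<alpha>
  proof -
    obtain \<rho> where \<rho>: "\<rho> \<in> K" "\<alpha> \<in> simplex_points \<rho>"
      using \<alpha> by (auto simp: realization_points_def)
    obtain w where w: "w \<in> \<rho>" "\<alpha> w > 0"
    proof -
      have "(\<Sum>v\<in>\<rho>. \<alpha> v) \<noteq> 0" and nonneg: "\<And>v. 0 \<le> \<alpha> v"
        using \<rho>(2) by (auto simp: simplex_points_def)
      then obtain w where "w \<in> \<rho>" "\<alpha> w \<noteq> 0" by (metis sum.neutral)
      then show ?thesis using that nonneg[of w] by (simp add: less_le)
    qed
    \<comment> \<open>The set where \<open>\<alpha>\<close> attains its maximum is the smallest nonempty superlevel set; its rank is a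
      coordinate that does not vanish.\<close>
    define \<mu> where "\<mu> = Max (\<alpha> ` V)"
    have wV: "w \<in> V" using w(1) sub[OF \<rho>(1)] by auto
    have "\<alpha> w \<le> \<mu>" using wV \<open>finite V\<close> by (simp add: \<mu>_def)
    then have "\<mu> > 0" using w(2) by linarith
    define \<sigma> where "\<sigma> = {v \<in> V. \<alpha> v = \<mu>}"
    have "\<mu> \<in> \<alpha> ` V" using wV \<open>finite V\<close> unfolding \<mu>_def by (intro Max_in) auto
    then have ne: "\<sigma> \<noteq> {}" by (auto simp: \<sigma>_def)
    have "\<sigma> \<subseteq> \<rho>" using \<rho>(2) \<open>\<mu> > 0\<close> by (force simp: \<sigma>_def simplex_points_def)
    then have \<sigma>K: "\<sigma> \<in> K" using sc \<rho>(1) by (auto simp: simplicial_complex_def)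
    have "\<alpha> v \<le> \<mu>" if "v \<in> V" for v using that \<open>finite V\<close> by (simp add: \<mu>_def)
    then have pos: "0 < level_weight V \<sigma> \<alpha>"
      using \<open>finite V\<close> sub[OF \<sigma>K] by (subst level_weight_pos_iff) (auto simp: \<sigma>_def less_le)
    define k where "k = rank \<sigma>"
    have "sgn \<tau> * level_weight V \<tau> \<alpha> = sgn \<sigma> * level_weight V \<tau> \<alpha>" if \<tau>: "\<tau> \<in> KK k" for \<tau>
    proof (cases "level_weight V \<tau> \<alpha> > 0")
      case True
      have "\<sigma> \<subseteq> \<tau> \<or> \<tau> \<subseteq> \<sigma>"
        using level_sets_nested[OF \<open>finite V\<close> _ _ pos True] sub \<sigma>K \<tau> by (auto simp: KK_def)
      then have "sgn \<tau> = sgn \<sigma>"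
        using sgn_chain[of \<tau> \<sigma>] sgn_chain[of \<sigma> \<tau>] \<tau> \<sigma>K ne by (auto simp: KK_def k_def)
      then show ?thesis by simp
    qed (use level_weight_nonneg[of V \<tau> \<alpha>] in auto)
    then have "F \<alpha> k = sgn \<sigma> * (\<Sum>\<tau>\<in>KK k. level_weight V \<tau> \<alpha>)"
      unfolding F_def sum_distrib_left by (rule sum.cong[OF refl])
    moreover have "0 < (\<Sum>\<tau>\<in>KK k. level_weight V \<tau> \<alpha>)"
      using pos \<sigma>K ne by (intro sum_pos2[of _ \<sigma>] finKK level_weight_nonneg) (auto simp: KK_def k_def)
    ultimately show ?thesis
      using sgn_nz[OF \<sigma>K ne] rank_le[OF \<sigma>K ne] by (intro exI[of _ k]) (auto simp: k_def)
  qed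
  have odd: "F (\<alpha> \<circ> \<nu>) k = - F \<alpha> k" for \<alpha> k
  proof -
    have bij: "bij_betw ((`) \<nu>) (KK k) (KK k)"
    proof (rule bij_betw_byWitness[of _ "(`) \<nu>"])
      have "\<nu> ` \<sigma> \<in> KK k" if "\<sigma> \<in> KK k" for \<sigma>
        using that nuK[of \<sigma>] rank_sym[of \<sigma>] by (simp add: KK_def)
      then show "(`) \<nu> ` KK k \<subseteq> KK k" by blast
      then show "(`) \<nu> ` KK k \<subseteq> KK k" .
    qed (auto simp: nu2)
    have "F \<alpha> k = (\<Sum>\<sigma>\<in>KK k. sgn (\<nu> ` \<sigma>) * level_weight V (\<nu> ` \<sigma>) \<alpha>)"
      unfolding F_def by (rule sum.reindex_bij_betw[OF bij, symmetric])
    also have "\<dots> = (\<Sum>\<sigma>\<in>KK k. - (sgn \<sigma> * level_weight V \<sigma> (\<alpha> \<circ> \<nu>)))"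
      by (intro sum.cong) (auto simp: level_weight_involution[OF inv nuV] sgn_odd KK_def)
    finally show ?thesis by (simp add: F_def sum_negf)
  qed
  let ?X = "subtopology (powertop_real UNIV) (realization_points K)"
  have cont_weight: "continuous_map ?X euclideanreal (\<lambda>\<alpha>. level_weight V \<sigma> \<alpha>)" if "\<sigma> \<in> K" for \<sigma>
  proof -
    have coord: "continuous_map ?X euclideanreal (\<lambda>\<alpha>. \<alpha> v)" for v
      by (intro continuous_map_from_subtopology continuous_map_product_projection) simp
    have "finite \<sigma>" using sub[OF that] \<open>finite V\<close> finite_subset by blast
    then show ?thesis
      unfolding level_weight_def using \<open>finite V\<close>
      by (intro continuous_map_prod continuous_map_real_max continuous_map_diff coord) auto
  qed
  have cont: "continuous_map ?X euclideanreal (\<lambda>\<alpha>. F \<alpha> k)" for k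
    unfolding F_def
    by (intro continuous_map_sum continuous_map_real_mult_left finKK cont_weight) (auto simp: KK_def)
  have "Z2_map_to_sphere K \<nu> m (\<lambda>\<alpha>. sphere_normalize m (F \<alpha>))"
    unfolding Z2_map_to_sphere_def
  proof (intro conjI ballI)
    show "continuous_map (realization K) (nsphere m) (\<lambda>\<alpha>. sphere_normalize m (F \<alpha>))"
      using nz cont by (intro continuous_map_realization_if_coordinatewise continuous_map_sphere_normalize) auto
    fix \<alpha>
    have "F (\<alpha> \<circ> \<nu>) = (\<lambda>k. - F \<alpha> k)" by (rule ext) (rule odd)
    then show "sphere_normalize m (F (\<alpha> \<circ> \<nu>)) = (\<lambda>i. - sphere_normalize m (F \<alpha>) i)"
      by (simp only: sphere_normalize_minus)
  qed
  then show ?thesis unfolding Z2_index_def by (intro Inf_lower) auto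
qed

section \<open>Bounding the index from below by a cross-polytope\<close>

text \<open>The sign patterns on \<open>v 0, \<dots>, v m\<close> span a possibly degenerate image of the boundary of a
cross-polytope in \<open>K\<close>. A point \<open>z\<close> of the sphere
is sent to the point with the same signs and with weights proportional to \<open>\<bar>z i\<bar>\<close>.\<close>

theorem octahedral_sphere_le_Z2_index:
  fixes K :: "'v set set" and v :: "nat \<Rightarrow> 'v"
  assumes fin: "finite K" and sc: "simplicial_complex K" and inv: "\<And>w. \<nu> (\<nu> w) = w"
    and signs: "\<And>b :: nat \<Rightarrow> bool. (\<lambda>i. if b i then v i else \<nu> (v i)) ` {..m} \<in> K"
  shows "enat m \<le> Z2_index K \<nu>"
proof -
  define \<beta> where "\<beta> z w = (\<Sum>i\<le>m. (if w = v i then max 0 (z i) else 0) + (if w = \<nu> (v i) then max 0 (- z i) else 0))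
      / (\<Sum>i\<le>m. \<bar>z i\<bar>)" for z :: "nat \<Rightarrow> real" and w
  have norm_pos: "0 < (\<Sum>i\<le>m. \<bar>z i\<bar>)" if z: "z \<in> topspace (nsphere m)" for z
  proof -
    obtain i where "i \<le> m" "1 / (m + 1) \<le> \<bar>z i\<bar>" by (rule nsphere_large_coord[OF z])
    moreover have "0 < 1 / real (m + 1)" by simp
    ultimately have "0 < \<bar>z i\<bar>" by linarith
    then show ?thesis using \<open>i \<le> m\<close> by (intro sum_pos2[of _ i]) auto
  qed
  have in_K: "\<beta> z \<in> realization_points K" if z: "z \<in> topspace (nsphere m)" for z
  proof -
    define \<sigma> where "\<sigma> = (\<lambda>i. if z i > 0 then v i else \<nu> (v i)) ` {..m}"
    have "\<sigma> \<in> K" unfolding \<sigma>_def by (rule signs)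
    have "finite \<sigma>" by (simp add: \<sigma>_def)
    have "(\<Sum>w\<in>\<sigma>. (if w = v i then max 0 (z i) else 0) + (if w = \<nu> (v i) then max 0 (- z i) else 0)) = \<bar>z i\<bar>"
      if "i \<le> m" for i
    proof -
      have "(if z i > 0 then v i else \<nu> (v i)) \<in> \<sigma>" using that by (auto simp: \<sigma>_def)
      then show ?thesis using \<open>finite \<sigma>\<close>
        by (cases "z i > 0") (auto simp: sum.distrib)
    qed
    then have "(\<Sum>w\<in>\<sigma>. \<beta> z w) = 1"
      using norm_pos[OF z] by (simp add: \<beta>_def sum.swap[of _ "{..m}"] flip: sum_divide_distrib)
    moreover have "0 \<le> \<beta> z w" for w
      unfolding \<beta>_def by (intro divide_nonneg_nonneg sum_nonneg) auto
    moreover have "\<beta> z w = 0" if "w \<notin> \<sigma>" for w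
    proof -
      have "w = v i \<Longrightarrow> z i \<le> 0" "w = \<nu> (v i) \<Longrightarrow> z i \<ge> 0" if "i \<le> m" for i
        using \<open>w \<notin> \<sigma>\<close> that by (force simp: \<sigma>_def)+
      then have "(if w = v i then max 0 (z i) else 0) + (if w = \<nu> (v i) then max 0 (- z i) else 0) = 0"
        if "i \<le> m" for i
        using that by (cases "w = v i"; cases "w = \<nu> (v i)") (fastforce simp: max_def)+
      then show ?thesis unfolding \<beta>_def by simp
    qed
    ultimately have "\<beta> z \<in> simplex_points \<sigma>" by (simp add: simplex_points_def)
    then show ?thesis using \<open>\<sigma> \<in> K\<close> by (auto simp: realization_points_def)
  qed
  have "continuous_map (nsphere m) euclideanreal (\<lambda>z. \<beta> z w)" for w
  proof -
    have "continuous_map (nsphere m) euclideanreal (\<lambda>z. if w = u then max 0 (z i) else 0)"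
      "continuous_map (nsphere m) euclideanreal (\<lambda>z. if w = u then max 0 (- z i) else 0)" for u i
      by (cases "w = u"; simp; intro continuous_intros continuous_map_nsphere_projection; simp)+
    then show ?thesis unfolding \<beta>_def
      using norm_pos by (intro continuous_intros continuous_map_nsphere_projection) force+
  qed
  then have cont: "continuous_map (nsphere m) (realization K) \<beta>"
    using in_K by (intro continuous_map_into_realization fin sc) (auto simp: continuous_map_componentwise_UNIV)
  have odd: "\<beta> (\<lambda>i. - z i) = \<beta> z \<circ> \<nu>" for z
  proof
    fix w
    have "\<nu> w = v i \<longleftrightarrow> w = \<nu> (v i)" "\<nu> w = \<nu> (v i) \<longleftrightarrow> w = v i" for i by (metis inv)+
    then show "\<beta> (\<lambda>i. - z i) w = (\<beta> z \<circ> \<nu>) w"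
      by (simp add: \<beta>_def add.commute cong: if_cong)
  qed
  show ?thesis
    unfolding Z2_index_def
  proof (rule Inf_greatest)
    fix x assume "x \<in> {enat d |d. \<exists>f. Z2_map_to_sphere K \<nu> d f}"
    then obtain d f where x: "x = enat d" and f: "Z2_map_to_sphere K \<nu> d f" by blast
    have "antipodal_map m d (f \<circ> \<beta>)"
      using f in_K continuous_map_compose[OF cont]
      by (auto simp: antipodal_map_def Z2_map_to_sphere_def odd topspace_realization)
    then show "enat m \<le> x" using Borsuk_Ulam x by simp
  qed
qed

section \<open>The sign complex of the Hadamard matrix\<close>

text \<open>Affine subspaces over the two-element field are the nonempty sets closed under sums of three elements. In this
form no base point or dimension has to be chosen.\<close>

definition triple_sum :: "nat \<Rightarrow> (nat \<Rightarrow> bit) \<Rightarrow> (nat \<Rightarrow> bit) \<Rightarrow> (nat \<Rightarrow> bit) \<Rightarrow> nat \<Rightarrow> bit" where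
  "triple_sum n a b c = (\<lambda>i\<in>{..<n}. a i + b i + c i)"

lemma triple_sum_apply: "i < n \<Longrightarrow> triple_sum n a b c i = a i + b i + c i"
  by (simp only: triple_sum_def restrict_apply lessThan_iff if_True)

lemma triple_sum_in_F2_space: "triple_sum n a b c \<in> F2_space n"
  by (simp add: triple_sum_def F2_space_def)

lemma triple_sum_cancel:
  assumes "s \<in> F2_space n"
  shows "triple_sum n (triple_sum n s a b) a b = s" "triple_sum n (triple_sum n a s b) a b = s"
proof -
  have cancel: "(x + y + z) + y + z = x" "(y + x + z) + y + z = x" for x y z :: bit
    by (cases x; cases y; cases z; simp)+
  have "triple_sum n (triple_sum n s a b) a b i = s i \<and> triple_sum n (triple_sum n a s b) a b i = s i" for i
  proof (cases "i < n")
    case True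
    then show ?thesis by (simp only: triple_sum_apply cancel simp_thms)
  next
    case False
    then show ?thesis using assms by (simp add: triple_sum_def F2_space_def PiE_iff extensional_def)
  qed
  then show "triple_sum n (triple_sum n s a b) a b = s" "triple_sum n (triple_sum n a s b) a b = s" by blast+
qed

lemma F2_dot_triple_sum:
  "F2_dot n (triple_sum n a b c) y = F2_dot n a y + F2_dot n b y + F2_dot n c y"
proof -
  have "F2_dot n (triple_sum n a b c) y = (\<Sum>i<n. a i * y i + b i * y i + c i * y i)"
    unfolding F2_dot_def
    by (intro sum.cong refl) (simp only: triple_sum_apply lessThan_iff distrib_right)
  then show ?thesis by (simp only: F2_dot_def sum.distrib)
qed

lemma hadamard_triple_sum:
  "hadamard n (triple_sum n a b c) y = hadamard n a y * hadamard n b y * hadamard n c y"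
proof -
  have "(-1) ^ of_bit (r + s) = (-1) ^ of_bit r * ((-1) ^ of_bit s :: int)" for r s :: bit
    by (cases r; cases s) auto
  then show ?thesis by (simp only: hadamard_def F2_dot_triple_sum)
qed

lemma finite_F2_space: "finite (F2_space n)"
  using card_F2_space[of n] by (metis card.infinite power_not_zero zero_neq_numeral)

definition supporting_rows :: "nat \<Rightarrow> (nat \<Rightarrow> bit) signed_index set \<Rightarrow> (nat \<Rightarrow> bit) set" where
  "supporting_rows n \<sigma> = {x \<in> F2_space n.
     \<sigma> \<subseteq> sigma_plus (F2_space n) (hadamard n x) \<or> \<sigma> \<subseteq> sigma_minus (F2_space n) (hadamard n x)}"

fun signed_entry :: "nat \<Rightarrow> (nat \<Rightarrow> bit) \<Rightarrow> (nat \<Rightarrow> bit) signed_index \<Rightarrow> int" where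
  "signed_entry n x (Pos y) = hadamard n x y"
| "signed_entry n x (Neg y) = - hadamard n x y"

lemma signed_entry_triple_sum:
  "signed_entry n (triple_sum n a b c) w = signed_entry n a w * signed_entry n b w * signed_entry n c w"
  by (cases w) (simp_all add: hadamard_triple_sum)

lemma sigma_plus_hadamard:
  "w \<in> sigma_plus (F2_space n) (hadamard n x) \<longleftrightarrow>
     (w \<in> Pos ` F2_space n \<union> Neg ` F2_space n \<and> signed_entry n x w = 1)"
  by (cases w) (auto simp: sigma_plus_def)

lemma sigma_minus_hadamard:
  "w \<in> sigma_minus (F2_space n) (hadamard n x) \<longleftrightarrow>
     (w \<in> Pos ` F2_space n \<union> Neg ` F2_space n \<and> signed_entry n x w = -1)"
  by (cases w) (auto simp: sigma_minus_def)

text \<open>A row belongs to the set when its signed entries are constant on \<open>\<sigma>\<close>, and rows multiply under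
addition of their indices.\<close>

lemma supporting_rows_triple_sum:
  assumes "a \<in> supporting_rows n \<sigma>" "b \<in> supporting_rows n \<sigma>" "c \<in> supporting_rows n \<sigma>"
  shows "triple_sum n a b c \<in> supporting_rows n \<sigma>"
proof -
  let ?V = "Pos ` F2_space n \<union> Neg ` F2_space n"
  have iff: "x \<in> supporting_rows n \<sigma> \<longleftrightarrow> x \<in> F2_space n \<and> \<sigma> \<subseteq> ?V \<and>
      ((\<forall>w\<in>\<sigma>. signed_entry n x w = 1) \<or> (\<forall>w\<in>\<sigma>. signed_entry n x w = -1))" for x
    by (auto simp: supporting_rows_def subset_iff sigma_plus_hadamard sigma_minus_hadamard)
  show ?thesis
    using assms triple_sum_in_F2_space[of n a b c] unfolding iff by (elim conjE disjE) (simp_all add: signed_entry_triple_sum)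
qed

lemma supporting_rows_antimono: "\<sigma> \<subseteq> \<tau> \<Longrightarrow> supporting_rows n \<tau> \<subseteq> supporting_rows n \<sigma>"
  by (auto simp: supporting_rows_def)

lemma finite_supporting_rows: "finite (supporting_rows n \<sigma>)"
  using finite_F2_space by (simp add: supporting_rows_def)

text \<open>For a row \<open>s\<close> that is lost when passing from \<open>\<sigma>\<close> to \<open>\<tau>\<close>, and any row \<open>t\<close> that is kept, translation by
\<open>s + t\<close> carries the rows that are kept injectively to rows that are lost.\<close>

lemma supporting_rows_halve:
  assumes sub: "\<sigma> \<subseteq> \<tau>" and ne: "supporting_rows n \<tau> \<noteq> {}"
    and neq: "supporting_rows n \<sigma> \<noteq> supporting_rows n \<tau>"
  shows "2 * card (supporting_rows n \<tau>) \<le> card (supporting_rows n \<sigma>)"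
proof -
  let ?S = "supporting_rows n \<sigma>" and ?T = "supporting_rows n \<tau>"
  have TS: "?T \<subseteq> ?S" by (rule supporting_rows_antimono[OF sub])
  obtain t where t: "t \<in> ?T" using ne by blast
  obtain s where s: "s \<in> ?S" "s \<notin> ?T" using TS neq by blast
  have F2: "x \<in> F2_space n" if "x \<in> ?S" for x using that by (simp add: supporting_rows_def)
  have "inj_on (\<lambda>x. triple_sum n x s t) ?T"
    by (rule inj_on_inverseI[where g = "\<lambda>x. triple_sum n x s t"]) (use F2 TS triple_sum_cancel in blast)
  moreover have "(\<lambda>x. triple_sum n x s t) ` ?T \<subseteq> ?S - ?T"
  proof (rule image_subsetI)
    fix x assume x: "x \<in> ?T"
    have "triple_sum n x s t \<in> ?S" using x s t TS by (intro supporting_rows_triple_sum) auto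
    moreover have "triple_sum n x s t \<notin> ?T"
    proof
      assume "triple_sum n x s t \<in> ?T"
      then have "triple_sum n (triple_sum n x s t) x t \<in> ?T"
        by (rule supporting_rows_triple_sum[OF _ x t])
      then show False using s F2[OF s(1)] by (simp add: triple_sum_cancel)
    qed
    ultimately show "triple_sum n x s t \<in> ?S - ?T" by blast
  qed
  ultimately have "card ?T \<le> card (?S - ?T)"
    using finite_supporting_rows by (metis card_inj_on_le finite_Diff)
  then show ?thesis
    using TS finite_supporting_rows card_Diff_subset[of ?T ?S] card_mono[of ?S ?T] by auto
qed

text \<open>The rank of a nonempty simplex \<open>\<sigma>\<close> is the dimension of its affine space of supporting rows, and its sign tells which of the
two facets of a chosen supporting row contains it.\<close>

lemma Z2_index_hadamard_le:
  "Z2_index (sign_complex (F2_space n) (F2_space n) (hadamard n)) flip_sign \<le> enat n"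
proof -
  let ?K = "sign_complex (F2_space n) (F2_space n) (hadamard n)"
  let ?X = "supporting_rows n"
  let ?plus = "\<lambda>x. sigma_plus (F2_space n) (hadamard n x)" and ?minus = "\<lambda>x. sigma_minus (F2_space n) (hadamard n x)"
  \<comment> \<open>The choice depends on the set of supporting rows only, so that a simplex and its mirror image choose
    the same row.\<close>
  define row where "row \<sigma> = (SOME x. x \<in> ?X \<sigma>)" for \<sigma>
  define sgn :: "(nat \<Rightarrow> bit) signed_index set \<Rightarrow> real"
    where "sgn \<sigma> = (if \<sigma> \<subseteq> ?plus (row \<sigma>) then 1 else -1)" for \<sigma>
  have K_iff: "\<sigma> \<in> ?K \<longleftrightarrow> ?X \<sigma> \<noteq> {}" for \<sigma>
    by (auto simp: sign_complex_def supporting_rows_def)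
  have row: "row \<sigma> \<in> ?X \<sigma>" if "\<sigma> \<in> ?K" for \<sigma>
    using that unfolding K_iff row_def by (simp add: some_in_eq)
  have disj: "?plus x \<inter> ?minus x = {}" for x
    by (auto simp: sigma_plus_hadamard sigma_minus_hadamard)
  have "inj (flip_sign :: (nat \<Rightarrow> bit) signed_index \<Rightarrow> _)" by (metis injI flip_sign_flip_sign)
  then have img: "flip_sign ` \<sigma> \<subseteq> flip_sign ` \<tau> \<longleftrightarrow> \<sigma> \<subseteq> \<tau>" for \<sigma> \<tau> :: "(nat \<Rightarrow> bit) signed_index set"
    by (rule inj_image_subset_iff)
  have flip: "flip_sign ` \<sigma> \<subseteq> ?plus x \<longleftrightarrow> \<sigma> \<subseteq> ?minus x" "flip_sign ` \<sigma> \<subseteq> ?minus x \<longleftrightarrow> \<sigma> \<subseteq> ?plus x" for \<sigma> x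
    using img[of \<sigma> "?minus x"] img[of \<sigma> "?plus x"] by (simp_all only: flip_sign_image_sigma)
  have X_flip: "?X (flip_sign ` \<sigma>) = ?X \<sigma>" for \<sigma>
    by (auto simp: supporting_rows_def flip)
  show ?thesis
  proof (rule Z2_index_le_rank[where rank = "\<lambda>\<sigma>. floor_log (card (?X \<sigma>))" and sgn = sgn])
    show "free_Z2_complex ?K flip_sign" by (rule free_Z2_complex_sign_complex[OF finite_F2_space])
    have "?K \<subseteq> Pow (Pos ` F2_space n \<union> Neg ` F2_space n)"
      by (auto simp: sign_complex_def subset_iff sigma_plus_hadamard sigma_minus_hadamard)
    then show "finite ?K" using finite_F2_space by (auto intro: finite_subset)
    fix \<sigma> assume \<sigma>: "\<sigma> \<in> ?K" "\<sigma> \<noteq> {}"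
    have "card (?X \<sigma>) \<le> 2 ^ n"
      unfolding card_F2_space[symmetric] by (intro card_mono finite_F2_space) (auto simp: supporting_rows_def)
    then show "floor_log (card (?X \<sigma>)) \<le> n"
      using floor_log_le_iff floor_log_power by metis
    show "floor_log (card (?X (flip_sign ` \<sigma>))) = floor_log (card (?X \<sigma>))" by (simp add: X_flip)
    show "sgn \<sigma> \<noteq> 0" by (simp add: sgn_def)
    have "row (flip_sign ` \<sigma>) = row \<sigma>" by (simp add: row_def X_flip)
    moreover have "\<sigma> \<subseteq> ?plus (row \<sigma>) \<longleftrightarrow> \<not> \<sigma> \<subseteq> ?minus (row \<sigma>)"
      using row[OF \<sigma>(1)] disj[of "row \<sigma>"] \<sigma>(2) by (auto simp: supporting_rows_def)
    ultimately show "sgn (flip_sign ` \<sigma>) = - sgn \<sigma>" by (simp add: sgn_def flip)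
  next
    fix \<sigma> \<tau> assume \<tau>: "\<tau> \<in> ?K" and ne: "\<sigma> \<noteq> {}" and sub: "\<sigma> \<subseteq> \<tau>"
      and eq: "floor_log (card (?X \<sigma>)) = floor_log (card (?X \<tau>))"
    have "?X \<tau> \<noteq> {}" using \<tau> by (simp add: K_iff)
    have X_eq: "?X \<sigma> = ?X \<tau>"
    proof (rule ccontr)
      assume "?X \<sigma> \<noteq> ?X \<tau>"
      then have "2 * card (?X \<tau>) \<le> card (?X \<sigma>)"
        using supporting_rows_halve[OF sub] \<open>?X \<tau> \<noteq> {}\<close> by blast
      then have "floor_log (2 * card (?X \<tau>)) \<le> floor_log (card (?X \<sigma>))" by (rule floor_log_le_iff)
      moreover have "card (?X \<tau>) > 0" using \<open>?X \<tau> \<noteq> {}\<close> finite_supporting_rows by (simp add: card_gt_0_iff)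
      ultimately show False using eq by simp
    qed
    then have row_eq: "row \<sigma> = row \<tau>" by (simp add: row_def)
    have "\<sigma> \<subseteq> ?plus (row \<tau>) \<longleftrightarrow> \<tau> \<subseteq> ?plus (row \<tau>)"
      using row[OF \<tau>] sub ne disj[of "row \<tau>"] unfolding supporting_rows_def by blast
    then show "sgn \<sigma> = sgn \<tau>" by (simp add: sgn_def row_eq)
  qed
qed

text \<open>The row with index \<open>x\<close> has entry \<open>(-1) ^ x i\<close> in the column of the standard basis vector \<open>e i\<close>, so that
every sign pattern on these columns occurs.\<close>

lemma le_Z2_index_hadamard:
  assumes "n \<ge> 1"
  shows "enat (n - 1) \<le> Z2_index (sign_complex (F2_space n) (F2_space n) (hadamard n)) flip_sign"
proof (rule octahedral_sphere_le_Z2_index)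
  let ?K = "sign_complex (F2_space n) (F2_space n) (hadamard n)"
  define e :: "nat \<Rightarrow> nat \<Rightarrow> bit" where "e i = (\<lambda>j\<in>{..<n}. if j = i then 1 else 0)" for i
  have "?K \<subseteq> Pow (Pos ` F2_space n \<union> Neg ` F2_space n)"
    by (auto simp: sign_complex_def subset_iff sigma_plus_hadamard sigma_minus_hadamard)
  then show "finite ?K" using finite_F2_space by (auto intro: finite_subset)
  show "simplicial_complex ?K"
    using free_Z2_complex_sign_complex[OF finite_F2_space] by (auto simp: free_Z2_complex_def)
  show "flip_sign (flip_sign w) = w" for w :: "(nat \<Rightarrow> bit) signed_index" by simp
  fix b :: "nat \<Rightarrow> bool"
  define x :: "nat \<Rightarrow> bit" where "x = (\<lambda>i\<in>{..<n}. if b i then 0 else 1)"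
  have x: "x \<in> F2_space n" and e: "e i \<in> F2_space n" for i by (auto simp: x_def e_def F2_space_def)
  have "hadamard n x (e i) = (if b i then 1 else -1)" if "i < n" for i
  proof -
    have "F2_dot n x (e i) = (\<Sum>j<n. if j = i then x i else 0)"
      unfolding F2_dot_def by (intro sum.cong) (auto simp: e_def)
    also have "\<dots> = x i" using that by simp
    finally show ?thesis using that by (simp add: hadamard_def x_def)
  qed
  then have "(\<lambda>i. if b i then Pos (e i) else flip_sign (Pos (e i))) ` {..n - 1} \<subseteq> sigma_plus (F2_space n) (hadamard n x)"
    using e assms by (auto simp: sigma_plus_def)
  then show "(\<lambda>i. if b i then Pos (e i) else flip_sign (Pos (e i))) ` {..n - 1} \<in> ?K"
    using x by (auto simp: sign_complex_def)
qed

theorem theorem32: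
  fixes n :: nat
  assumes "n \<ge> 1"
  shows "enat (n - 1) \<le> Z2_index (sign_complex (F2_space n) (F2_space n) (hadamard n)) flip_sign \<and>
    Z2_index (sign_complex (F2_space n) (F2_space n) (hadamard n)) flip_sign \<le> enat (2 * n + 1)"
proof
  show "enat (n - 1) \<le> Z2_index (sign_complex (F2_space n) (F2_space n) (hadamard n)) flip_sign"
    using assms by (rule le_Z2_index_hadamard)
  have "Z2_index (sign_complex (F2_space n) (F2_space n) (hadamard n)) flip_sign \<le> enat n"
    by (rule Z2_index_hadamard_le)
  also have "enat n \<le> enat (2 * n + 1)" by simp
  finally show "Z2_index (sign_complex (F2_space n) (F2_space n) (hadamard n)) flip_sign \<le> enat (2 * n + 1)" .
qed

end
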